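(* Let $R$, $B$ and $G$ be three finite sets of lines in $\mathbb{R}^3$ in general position, each with an even number of lines. Then there is a line $\ell$ in $\mathbb{R}^3$ such that $\ell$ lies below exactly $|R|/2$ lines of $R$, exactly $|B|/2$ lines of $B$ and exactly $|G|/2$ lines of $G$.
   Context: Vertical means parallel to the $z$-axis. For two lines $\ell,\ell'$ in $\mathbb{R}^3$ in general position, $\ell$ is above $\ell'$ (equivalently, $\ell'$ lies below $\ell$) if the unique vertical line that intersects both $\ell$ and $\ell'$ visits first $\ell$ and then $\ell'$ when traversed from top to bottom. (If there is no vertical line meeting both, neither is counted as lying below the other.) Here, that the lines of $R$, $B$, $G$ are in general position means that for the collection of all lines in $R\cup B\cup G$: (i) no two lines are parallel; (ii) no line is vertical; (iii) no line intersects the $z$-axis; (iv) for any four of the lines, if there is a line intersecting all of them, then the (unique) vertical plane containing this common intersecting line does not go through the origin.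
   Formalization: The sets R, B, G are assumed pairwise disjoint, and any two distinct lines of the collection are assumed to have a unique vertical line meeting both (projections to the xy-plane not parallel); with (i)-(iv) alone the claim is false, e.g. for the lines y = c, cz = x+1, c = 1,...,6. *)

theory Defs
  imports "HOL-Analysis.Analysis"
begin

definition is_line :: "(real ^ 3) set \<Rightarrow> bool" where
  "is_line L \<longleftrightarrow> affine L \<and> aff_dim L = 1"

definition z_axis :: "(real ^ 3) set" where
  "z_axis = {x. x $ 1 = 0 \<and> x $ 2 = 0}"

text \<open>\<^const>\<open>affine_parallel\<close> is translation equivalence, so the z-axis itself
  counts as vertical.\<close>

definition vertical_line :: "(real ^ 3) set \<Rightarrow> bool" where
  "vertical_line v \<longleftrightarrow> is_line v \<and> affine_parallel z_axis v"

definition vertical_plane :: "(real ^ 3) set \<Rightarrow> bool" where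
  "vertical_plane P \<longleftrightarrow> affine P \<and> aff_dim P = 2 \<and> (\<exists>v \<subseteq> P. vertical_line v)"

definition vertical_transversal ::
    "(real ^ 3) set \<Rightarrow> (real ^ 3) set \<Rightarrow> (real ^ 3) set \<Rightarrow> bool" where
  "vertical_transversal v L L' \<longleftrightarrow> vertical_line v \<and> v \<inter> L \<noteq> {} \<and> v \<inter> L' \<noteq> {}"

text \<open>The position of two lines needed to compare them vertically.  For non-vertical lines it
  says that their projections to the xy-plane are neither parallel nor equal.  This does not follow
  from \<open>general_position\<close> below: the six lines y = c, c z = x + 1 for c = 1, ..., 6 are in general
  position, but coloured 1, 2 / 3, 4 / 5, 6 they have no common bisector.\<close>

definition vertically_comparable :: "(real ^ 3) set \<Rightarrow> (real ^ 3) set \<Rightarrow> bool" where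
  "vertically_comparable L L' \<longleftrightarrow> (\<exists>!v. vertical_transversal v L L')"

text \<open>If there is no vertical transversal, or more than one, or if the lines meet on it, then
  neither line is below the other.  A vertical line is neither below nor above any line, since
  its only vertical transversal meets it in points of every height.\<close>

definition lies_below :: "(real ^ 3) set \<Rightarrow> (real ^ 3) set \<Rightarrow> bool" where
  "lies_below L L' \<longleftrightarrow> vertically_comparable L L' \<and>
     (\<forall>v. vertical_transversal v L L' \<longrightarrow> (\<forall>p \<in> v \<inter> L. \<forall>q \<in> v \<inter> L'. p $ 3 < q $ 3))"

text \<open>In the last condition a common transversal \<open>m\<close> that is itself vertical lies in several
  vertical planes, one of them through the origin; so no four of the lines have one.\<close>

definition general_position :: "(real ^ 3) set set \<Rightarrow> bool" where
  "general_position \<L> \<longleftrightarrow>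
     pairwise (\<lambda>L L'. \<not> affine_parallel L L') \<L> \<and>
     (\<forall>L\<in>\<L>. \<not> vertical_line L) \<and>
     (\<forall>L\<in>\<L>. L \<inter> z_axis = {}) \<and>
     (\<forall>\<A> \<subseteq> \<L>. card \<A> = 4 \<longrightarrow>
        (\<forall>m. is_line m \<and> (\<forall>L\<in>\<A>. m \<inter> L \<noteq> {}) \<longrightarrow>
          (\<forall>P. vertical_plane P \<and> m \<subseteq> P \<longrightarrow> 0 \<notin> P)))"

end

theory Submission
  imports Defs
begin

text \<open>
  In the vertical plane through the z-axis with angle \<open>\<theta>\<close>, every given line becomes a point, and a
  line in that plane with slope angle \<open>\<psi>\<close> bisects a class if its offset lies between the two middle
  offsets of the points of that class.  Choose such an offset \<open>m\<close> for each class, continuously in \<open>(\<theta>, \<psi>)\<close> even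
  where a point goes to infinity.  Then \<open>m\<close> changes sign under \<open>\<psi> \<mapsto> \<psi> + pi\<close> and is invariant under
  \<open>(\<theta>, \<psi>) \<mapsto> (\<theta> + pi, -\<psi>)\<close>, and a winding number argument shows that the three offsets agree somewhere.

  The common line halves every class up to ties.  By general position at most three of the lines meet it,
  and at most one more is parallel to the plane.  Only one class, or one class besides that of the
  parallel line, can need repair, and this is done by moving the line out of the pencil: a
  generic shift of the plane and change of slope separates the tied lines, a suitable offset then
  halves the classes, and rotating the plane finally puts the parallel line on the desired side.
\<close>

section \<open>Medians\<close>

text \<open>The strict inequalities admit at most one \<open>M\<close>. For odd cardinality it is
  the middle value; for even cardinality it exists only if the two middle values coincide.\<close>

definition is_median :: "'a set \<Rightarrow> ('a \<Rightarrow> real) \<Rightarrow> real \<Rightarrow> bool" where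
  "is_median S f M \<longleftrightarrow>
     2 * card {x \<in> S. f x < M} < card S \<and> 2 * card {x \<in> S. M < f x} < card S"

definition median :: "'a set \<Rightarrow> ('a \<Rightarrow> real) \<Rightarrow> real" where
  "median S f = (SOME M. is_median S f M)"

lemma card_le_plus_greater:
  fixes f :: "'a \<Rightarrow> real"
  assumes "finite S"
  shows "card S = card {x \<in> S. f x \<le> M} + card {x \<in> S. M < f x}"
proof -
  have "S = {x \<in> S. f x \<le> M} \<union> {x \<in> S. M < f x}" by auto
  moreover have "card ({x \<in> S. f x \<le> M} \<union> {x \<in> S. M < f x}) =
      card {x \<in> S. f x \<le> M} + card {x \<in> S. M < f x}"
    using assms by (intro card_Un_disjoint) auto
  ultimately show ?thesis by simp
qed

lemma card_less_plus_ge: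
  fixes f :: "'a \<Rightarrow> real"
  assumes "finite S"
  shows "card S = card {x \<in> S. f x < M} + card {x \<in> S. M \<le> f x}"
proof -
  have "S = {x \<in> S. f x < M} \<union> {x \<in> S. M \<le> f x}" by auto
  moreover have "card ({x \<in> S. f x < M} \<union> {x \<in> S. M \<le> f x}) =
      card {x \<in> S. f x < M} + card {x \<in> S. M \<le> f x}"
    using assms by (intro card_Un_disjoint) auto
  ultimately show ?thesis by simp
qed

text \<open>Otherwise every member with \<open>g\<close> at most \<open>M'\<close> has
  \<open>f\<close> below \<open>M\<close>; but the former are more than half of \<open>S\<close> and
  the latter fewer than half. Uniqueness and continuity of the median both come from this
  inequality.\<close>

lemma median_perturb_le:
  assumes fin: "finite S" and f: "is_median S f M" and g: "is_median S g M'"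
    and le: "\<And>x. x \<in> S \<Longrightarrow> f x \<le> g x + \<delta>"
  shows "M \<le> M' + \<delta>"
proof (rule ccontr)
  assume "\<not> M \<le> M' + \<delta>"
  then have "{x \<in> S. g x \<le> M'} \<subseteq> {x \<in> S. f x < M}"
    using le by force
  then have "card {x \<in> S. g x \<le> M'} \<le> card {x \<in> S. f x < M}"
    using fin by (intro card_mono) auto
  then show False
    using card_le_plus_greater[OF fin, of g M'] f g unfolding is_median_def by linarith
qed

lemma median_unique:
  assumes "finite S" "is_median S f M" "is_median S f M'"
  shows "M = M'"
  using median_perturb_le[OF assms, of 0] median_perturb_le[OF assms(1,3,2), of 0] by simp

lemma median_eqI:
  assumes "finite S" "is_median S f M"
  shows "median S f = M"
  using median_unique[OF assms(1) _ assms(2)] assms(2) someI[of "is_median S f" M]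
  unfolding median_def by blast

lemma is_median_median:
  assumes fin: "finite S" and odd: "odd (card S)"
  shows "is_median S f (median S f)"
proof -
  \<comment> \<open>The middle value is the least value attained on \<open>S\<close> that bounds
    more than half of the values from above.\<close>
  define A where "A = {y \<in> f ` S. card S < 2 * card {x \<in> S. f x \<le> y}}"
  define M where "M = Min A"
  have ne: "S \<noteq> {}" using odd by auto
  have "{x \<in> S. f x \<le> Max (f ` S)} = S"
    using fin by auto
  moreover have "card S > 0" using fin ne by (simp add: card_gt_0_iff)
  moreover have "Max (f ` S) \<in> f ` S" using fin ne by simp
  ultimately have "Max (f ` S) \<in> A"
    unfolding A_def by simp
  then have MA: "M \<in> A" unfolding M_def using fin by (intro Min_in) (auto simp: A_def)
  have Mmin: "M \<le> y" if "y \<in> A" for y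
    unfolding M_def using that fin by (simp add: A_def)
  have up: "2 * card {x \<in> S. M < f x} < card S"
    using MA card_le_plus_greater[OF fin, of f M] unfolding A_def by simp
  have "2 * card {x \<in> S. f x < M} < card S"
  proof (rule ccontr)
    let ?B = "{x \<in> S. f x < M}"
    \<comment> \<open>Oddness rules out an exact half, so more than half lie below \<open>M\<close>.
      Then the largest value below \<open>M\<close> already belongs to \<open>A\<close>, against
      minimality.\<close>
    assume "\<not> 2 * card ?B < card S"
    then have big: "card S < 2 * card ?B" using odd
      by (metis dvd_triv_left linorder_neqE_nat)
    then have "card ?B \<noteq> 0" by linarith
    then have "?B \<noteq> {}" by (metis card.empty)
    then have in_B: "Max (f ` ?B) \<in> f ` ?B" using fin by (intro Max_in) auto
    have "?B \<subseteq> {x \<in> S. f x \<le> Max (f ` ?B)}" using fin by auto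
    then have "card ?B \<le> card {x \<in> S. f x \<le> Max (f ` ?B)}"
      using fin by (intro card_mono) auto
    then have "Max (f ` ?B) \<in> A" using in_B big unfolding A_def by auto
    then show False using Mmin in_B by force
  qed
  then have "is_median S f M" using up by (simp add: is_median_def)
  then show ?thesis unfolding median_def by (rule someI)
qed

lemma median_cong: "(\<And>x. x \<in> S \<Longrightarrow> f x = g x) \<Longrightarrow> median S f = median S g"
  unfolding median_def is_median_def by (metis (mono_tags, lifting) Collect_cong)

lemma median_zero:
  assumes "finite S" "odd (card S)"
  shows "median S (\<lambda>_. 0) = 0"
  using assms by (intro median_eqI) (auto simp: is_median_def odd_pos)

lemma median_scale:
  assumes "finite S" "odd (card S)" "0 < c"
  shows "median S (\<lambda>x. c * f x) = c * median S f"
  using is_median_median[OF assms(1,2), of f] assms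
  by (intro median_eqI) (auto simp: is_median_def)

lemma median_minus:
  assumes "finite S" "odd (card S)"
  shows "median S (\<lambda>x. - f x) = - median S f"
  using is_median_median[OF assms, of f] assms
  by (intro median_eqI) (auto simp: is_median_def)

text \<open>By \<open>median_perturb_le\<close> in both directions, moving every value by less than
  \<open>r/2\<close> moves the median by at most \<open>r/2\<close>.\<close>

lemma continuous_on_median:
  fixes f :: "'b::topological_space \<Rightarrow> 'a \<Rightarrow> real"
  assumes fin: "finite S" and odd: "odd (card S)"
    and cont: "\<And>x. x \<in> S \<Longrightarrow> continuous_on T (\<lambda>y. f y x)"
  shows "continuous_on T (\<lambda>y. median S (f y))"
  unfolding continuous_on_def
proof (intro ballI tendstoI)
  fix y and r :: real assume y: "y \<in> T" and r: "0 < r"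
  have "\<forall>\<^sub>F z in at y within T. \<forall>x\<in>S. dist (f z x) (f y x) < r/2"
    using fin cont y r unfolding continuous_on_def
    by (intro eventually_ball_finite ballI tendstoD) auto
  then show "\<forall>\<^sub>F z in at y within T. dist (median S (f z)) (median S (f y)) < r"
  proof eventually_elim
    case (elim z)
    then have *: "\<bar>f z x - f y x\<bar> < r/2" if "x \<in> S" for x using that by (simp add: dist_real_def)
    have "median S (f z) \<le> median S (f y) + r/2"
      by (rule median_perturb_le[OF fin is_median_median[OF fin odd] is_median_median[OF fin odd]])
        (drule *, linarith)
    moreover have "median S (f y) \<le> median S (f z) + r/2"
      by (rule median_perturb_le[OF fin is_median_median[OF fin odd] is_median_median[OF fin odd]])
        (drule *, linarith)
    ultimately show ?case using r by (simp add: dist_real_def)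
  qed
qed

section \<open>Halving an even family at a weighted mean of medians\<close>

text \<open>The first case leaves no zeros. The mixed case, half on one side and fewer on the other,
  is excluded, so a class of even size that has a zero has at least two, enough to fill both sides
  up to half.\<close>

definition halved :: "'a set \<Rightarrow> ('a \<Rightarrow> real) \<Rightarrow> bool" where
  "halved X s \<longleftrightarrow>
     2 * card {L \<in> X. s L < 0} = card X \<and> 2 * card {L \<in> X. 0 < s L} = card X \<or>
     2 * card {L \<in> X. s L < 0} < card X \<and> 2 * card {L \<in> X. 0 < s L} < card X"

text \<open>The squares make the weights nonnegative and invariant under a change of sign of
  \<open>e\<close>, which occurs when the plane turns by \<open>pi\<close>.\<close>

definition omega :: "'a set \<Rightarrow> ('a \<Rightarrow> real) \<Rightarrow> 'a \<Rightarrow> real" where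
  "omega X e L = (\<Prod>K\<in>X - {L}. (e K)\<^sup>2)"

text \<open>Below, \<open>e L = 0\<close> means that the line \<open>L\<close> is parallel to the plane, and \<open>N L / e L\<close> is the offset
  of its intersection with the plane otherwise.  \<open>cleared X e N L J\<close> is \<open>omega X e L * (N J / e J)\<close> written
  without division, so it stays continuous where an offset goes to infinity.\<close>

definition cleared :: "'a set \<Rightarrow> ('a \<Rightarrow> real) \<Rightarrow> ('a \<Rightarrow> real) \<Rightarrow> 'a \<Rightarrow> 'a \<Rightarrow> real" where
  "cleared X e N L J = e J * N J * (\<Prod>K\<in>X - {L} - {J}. (e K)\<^sup>2)"

text \<open>The midpoint of the two middle values of an even family is the mean of the medians left after
  removing one member.  The weights \<open>omega\<close> make this mean continuous: when the offset of \<open>L\<close> goes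
  through infinity, only the median without \<open>L\<close> survives.\<close>

definition middle :: "'a set \<Rightarrow> ('a \<Rightarrow> real) \<Rightarrow> ('a \<Rightarrow> real) \<Rightarrow> real" where
  "middle X e N =
     (\<Sum>L\<in>X. median (X - {L}) (cleared X e N L)) / (\<Sum>L\<in>X. omega X e L)"

lemma cleared_eq:
  assumes "finite X" "J \<in> X - {L}" "e J \<noteq> 0"
  shows "cleared X e N L J = omega X e L * (N J / e J)"
proof -
  have "omega X e L = (e J)\<^sup>2 * (\<Prod>K\<in>X - {L} - {J}. (e K)\<^sup>2)"
    unfolding omega_def using assms by (intro prod.remove) auto
  then show ?thesis using assms(3) by (simp add: cleared_def power2_eq_square)
qed

lemma omega_nonneg: "0 \<le> omega X e L"
  unfolding omega_def by (intro prod_nonneg) simp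

lemma omega_pos: "finite X \<Longrightarrow> (\<And>K. K \<in> X - {L} \<Longrightarrow> e K \<noteq> 0) \<Longrightarrow> 0 < omega X e L"
  unfolding omega_def by (intro prod_pos) auto

lemma odd_card_remove:
  assumes "finite X" "even (card X)" "L \<in> X"
  shows "odd (card (X - {L}))"
  using assms by (metis card_Suc_Diff1 even_Suc)

lemma median_cleared:
  assumes fin: "finite X" and even: "even (card X)" and L: "L \<in> X"
    and e: "\<And>K. K \<in> X - {L} \<Longrightarrow> e K \<noteq> 0"
  shows "median (X - {L}) (cleared X e N L) = omega X e L * median (X - {L}) (\<lambda>J. N J / e J)"
proof -
  have "median (X - {L}) (cleared X e N L) = median (X - {L}) (\<lambda>J. omega X e L * (N J / e J))"
    using fin e by (intro median_cong cleared_eq) auto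
  also have "\<dots> = omega X e L * median (X - {L}) (\<lambda>J. N J / e J)"
    using fin odd_card_remove[OF fin even L] omega_pos[OF fin e] by (intro median_scale) auto
  finally show ?thesis .
qed

text \<open>The factor \<open>e L = 0\<close> kills the weight and the cleared values of every other
  member, so only the summand of \<open>L\<close> survives in both sums.\<close>

lemma middle_at_parallel:
  assumes fin: "finite X" and even: "even (card X)" and L: "L \<in> X" and eL: "e L = 0"
    and e: "\<And>K. K \<in> X - {L} \<Longrightarrow> e K \<noteq> 0"
  shows "middle X e N = median (X - {L}) (\<lambda>J. N J / e J)"
proof -
  have om: "omega X e K = 0" if "K \<in> X - {L}" for K
    unfolding omega_def using that L eL fin by (intro prod_zero bexI[of _ L]) auto
  have cl: "cleared X e N K J = 0" if "K \<in> X - {L}" "J \<in> X - {K}" for K J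
  proof (cases "J = L")
    case False
    then have "(\<Prod>K\<in>X - {K} - {J}. (e K)\<^sup>2) = 0"
      using that L eL fin by (intro prod_zero bexI[of _ L]) auto
    then show ?thesis by (simp add: cleared_def)
  qed (simp add: cleared_def eL)
  have med: "median (X - {K}) (cleared X e N K) = 0" if "K \<in> X - {L}" for K
    using median_cong[of "X - {K}" "cleared X e N K" "\<lambda>_. 0"] cl[OF that]
      median_zero[of "X - {K}"] fin odd_card_remove[OF fin even, of K] that by auto
  have "middle X e N = median (X - {L}) (cleared X e N L) / omega X e L"
    unfolding middle_def using med om by (simp add: sum.remove[OF fin L])
  then show ?thesis
    using median_cleared[of X L e N] omega_pos[of X L e] fin even L e by simp
qed

lemma middle_weighted_mean:
  assumes fin: "finite X" and even: "even (card X)" and e: "\<And>K. K \<in> X \<Longrightarrow> e K \<noteq> 0"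
  shows "middle X e N = (\<Sum>L\<in>X. omega X e L * median (X - {L}) (\<lambda>J. N J / e J)) / (\<Sum>L\<in>X. omega X e L)"
proof -
  have "median (X - {L}) (cleared X e N L) = omega X e L * median (X - {L}) (\<lambda>J. N J / e J)"
    if "L \<in> X" for L
    using median_cleared[OF fin even that] e by simp
  then show ?thesis unfolding middle_def by (simp cong: sum.cong)
qed

lemma weighted_mean_less:
  fixes w M :: "'a \<Rightarrow> real"
  assumes fin: "finite X" and w: "\<And>L. L \<in> X \<Longrightarrow> 0 < w L"
    and le: "\<And>L. L \<in> X \<Longrightarrow> M L \<le> m" and ex: "L0 \<in> X" "M L0 < m"
  shows "(\<Sum>L\<in>X. w L * M L) / (\<Sum>L\<in>X. w L) < m"
proof -
  have "(\<Sum>L\<in>X. w L * M L) < (\<Sum>L\<in>X. w L * m)"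
    using fin w le ex by (intro sum_strict_mono_ex1) (auto intro!: mult_left_mono less_imp_le bexI[of _ L0])
  moreover have "0 < (\<Sum>L\<in>X. w L)" using fin w ex(1) by (intro sum_pos) auto
  ultimately show ?thesis
    unfolding sum_distrib_right[symmetric] by (simp add: divide_less_eq mult.commute)
qed

text \<open>If more than half of the values lie below \<open>m\<close>, then by parity removing any
  one member still leaves half of \<open>card X\<close> below \<open>m\<close>, so every median is
  below \<open>m\<close>. If exactly half do and some value equals \<open>m\<close>, removing that
  member gives a median below \<open>m\<close>, and no other median exceeds \<open>m\<close>. Either
  way the mean would be less than \<open>m\<close>.\<close>

lemma card_less_half_of_mean:
  fixes v w :: "'a \<Rightarrow> real"
  assumes fin: "finite X" and even: "even (card X)" and w: "\<And>L. L \<in> X \<Longrightarrow> 0 < w L"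
    and m: "m = (\<Sum>L\<in>X. w L * median (X - {L}) v) / (\<Sum>L\<in>X. w L)"
    and ge: "card X \<le> 2 * card {L \<in> X. v L < m}" and ne: "X \<noteq> {}"
  shows "2 * card {L \<in> X. v L < m} = card X \<and> card {L \<in> X. v L = m} = 0"
proof -
  let ?A = "{L \<in> X. v L < m}"
  have cX: "0 < card X" using fin ne by (simp add: card_gt_0_iff)
  have med: "is_median (X - {L}) v (median (X - {L}) v)" if "L \<in> X" for L
    using fin odd_card_remove[OF fin even that] by (intro is_median_median) auto
  have cd: "card (X - {L}) + 1 = card X" if "L \<in> X" for L
    using fin that cX by simp
  have low: "median (X - {L}) v < m" if "L \<in> X" "card X \<le> 2 * card (?A - {L})" for L
  proof (rule ccontr)
    assume "\<not> ?thesis"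
    then have "card (?A - {L}) \<le> card {x \<in> X - {L}. v x < median (X - {L}) v}"
      using fin by (intro card_mono) auto
    then show False using med[OF that(1)] that(2) cd[OF that(1)] by (simp add: is_median_def)
  qed
  have up: "median (X - {L}) v \<le> m"
    if "L \<in> X" "card X \<le> 2 * (card {L\<in>X. v L \<le> m} - 1)" for L
  proof (rule ccontr)
    assume "\<not> ?thesis"
    then have "card ({L\<in>X. v L \<le> m} - {L}) \<le> card {x \<in> X - {L}. v x < median (X - {L}) v}"
      using fin by (intro card_mono) auto
    moreover have "card {L\<in>X. v L \<le> m} - 1 \<le> card ({L\<in>X. v L \<le> m} - {L})"
      by (simp add: card_Diff_singleton_if)
    ultimately show False using med[OF that(1)] that(2) cd[OF that(1)] by (simp add: is_median_def)
  qed
  have split: "card {L\<in>X. v L \<le> m} = card ?A + card {L\<in>X. v L = m}"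
  proof -
    have "{L\<in>X. v L \<le> m} = ?A \<union> {L\<in>X. v L = m}" by auto
    then show ?thesis using fin by (simp, subst card_Un_disjoint) auto
  qed
  have no: False if all: "\<And>L. L \<in> X \<Longrightarrow> median (X - {L}) v \<le> m"
    and ex: "L \<in> X" "median (X - {L}) v < m" for L
    using weighted_mean_less[of X w "\<lambda>L. median (X - {L}) v" m L] fin w all ex m by simp
  have eq: "2 * card ?A = card X"
  proof (rule ccontr)
    assume "2 * card ?A \<noteq> card X"
    then have "card X < 2 * card ?A" using ge by simp
    then have "card X + 2 \<le> 2 * card ?A" using even by presburger
    then have all: "card X \<le> 2 * card (?A - {L})" for L
      by (simp add: card_Diff_singleton_if) linarith
    have lt: "median (X - {L}) v < m" if "L \<in> X" for L using low[OF that all] .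
    obtain L where "L \<in> X" using ne by auto
    then show False using no[OF less_imp_le[OF lt]] lt by blast
  qed
  moreover have "card {L \<in> X. v L = m} = 0"
  proof (rule ccontr)
    assume ne: "\<not> ?thesis"
    then have "{L \<in> X. v L = m} \<noteq> {}" by (intro notI) simp
    then obtain L where L: "L \<in> X" "v L = m" by blast
    have "card X \<le> 2 * (card {L\<in>X. v L \<le> m} - 1)" using split eq ne by linarith
    moreover have "card X \<le> 2 * card (?A - {L})" using L eq by simp
    ultimately show False using no[OF up L(1) low[OF L(1)]] by blast
  qed
  ultimately show ?thesis by blast
qed

text \<open>The preceding bound, applied to \<open>v\<close> and to its negative, controls both
  sides: each has fewer than half, or exactly half without ties.\<close>

lemma halved_of_mean:
  fixes v w :: "'a \<Rightarrow> real"
  assumes fin: "finite X" and even: "even (card X)" and w: "\<And>L. L \<in> X \<Longrightarrow> 0 < w L"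
    and m: "m = (\<Sum>L\<in>X. w L * median (X - {L}) v) / (\<Sum>L\<in>X. w L)"
  shows "halved X (\<lambda>L. m - v L)"
proof (cases "X = {}")
  case False
  have odd: "odd (card (X - {L}))" if "L \<in> X" for L
    using odd_card_remove[OF fin even that] .
  have m': "- m = (\<Sum>L\<in>X. w L * median (X - {L}) (\<lambda>L. - v L)) / (\<Sum>L\<in>X. w L)"
    unfolding m using median_minus[OF finite_Diff[OF fin] odd]
    by (simp add: sum_negf cong: sum.cong)
  have split: "card X = card {L \<in> X. v L < m} + card {L \<in> X. m < v L} + card {L \<in> X. v L = m}"
  proof -
    have "card {L\<in>X. v L \<le> m} = card {L \<in> X. v L < m} + card {L\<in>X. v L = m}"
    proof -
      have "{L\<in>X. v L \<le> m} = {L \<in> X. v L < m} \<union> {L\<in>X. v L = m}" by auto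
      then show ?thesis using fin by (simp, subst card_Un_disjoint) auto
    qed
    then show ?thesis using card_le_plus_greater[OF fin, of v m] by simp
  qed
  have "card X \<le> 2 * card {L \<in> X. v L < m} \<Longrightarrow>
      2 * card {L \<in> X. v L < m} = card X \<and> card {L \<in> X. v L = m} = 0"
    using card_less_half_of_mean[OF fin even w m _ False] .
  moreover have "card X \<le> 2 * card {L \<in> X. m < v L} \<Longrightarrow>
      2 * card {L \<in> X. m < v L} = card X \<and> card {L \<in> X. v L = m} = 0"
    using card_less_half_of_mean[OF fin even w m' _ False] by simp
  ultimately show ?thesis
    using split unfolding halved_def diff_less_0_iff_less diff_gt_0_iff_gt by linarith
qed (simp add: halved_def)

lemma continuous_on_middle:
  fixes e N :: "'b::topological_space \<Rightarrow> 'a \<Rightarrow> real"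
  assumes fin: "finite X" and even: "even (card X)"
    and e: "\<And>L. L \<in> X \<Longrightarrow> continuous_on T (\<lambda>y. e y L)"
    and N: "\<And>L. L \<in> X \<Longrightarrow> continuous_on T (\<lambda>y. N y L)"
    and one: "\<And>y K L. y \<in> T \<Longrightarrow> K \<in> X \<Longrightarrow> L \<in> X \<Longrightarrow> e y K = 0 \<Longrightarrow> e y L = 0 \<Longrightarrow> K = L"
  shows "continuous_on T (\<lambda>y. middle X (e y) (N y))"
proof (cases "X = {}")
  case False
  \<comment> \<open>The weights are nonnegative, and one is positive: that of the member with
    \<open>e y L = 0\<close> if there is one, that of any member otherwise.\<close>
  have "(\<Sum>L\<in>X. omega X (e y) L) \<noteq> 0" if y: "y \<in> T" for y
  proof -
    obtain L where L: "L \<in> X" "\<And>K. K \<in> X - {L} \<Longrightarrow> e y K \<noteq> 0"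
    proof (cases "\<exists>L\<in>X. e y L = 0")
      case True
      then show ?thesis using that one[OF y] by blast
    next
      case False
      then show ?thesis using that \<open>X \<noteq> {}\<close> by blast
    qed
    then have "0 < omega X (e y) L" by (intro omega_pos fin)
    then show ?thesis
      using sum_pos2[OF fin L(1), of "omega X (e y)"] by (simp add: omega_nonneg)
  qed
  moreover have "continuous_on T (\<lambda>y. omega X (e y) L)" for L
    unfolding omega_def using e by (intro continuous_intros) auto
  moreover have "continuous_on T (\<lambda>y. median (X - {L}) (cleared X (e y) (N y) L))" if "L \<in> X" for L
    unfolding cleared_def using e N fin odd_card_remove[OF fin even that]
    by (intro continuous_on_median continuous_intros) auto
  ultimately show ?thesis
    unfolding middle_def by (intro continuous_intros) auto
qed (simp add: middle_def)

lemma middle_minus: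
  assumes fin: "finite X" and even: "even (card X)"
  shows "middle X e (\<lambda>L. - N L) = - middle X e N"
proof -
  have "median (X - {L}) (cleared X e (\<lambda>L. - N L) L) = - median (X - {L}) (cleared X e N L)"
    if "L \<in> X" for L
    using median_minus[OF finite_Diff[OF fin] odd_card_remove[OF fin even that], of "cleared X e N L"]
    by (simp add: cleared_def[abs_def])
  then show ?thesis unfolding middle_def by (simp add: sum_negf cong: sum.cong)
qed

text \<open>This gives the invariance under (\<theta>, \<psi>) -> (\<theta> + pi, -\<psi>), where
  \<open>e\<close> and \<open>N\<close> both change sign and the offsets \<open>N L / e L\<close> do
  not.\<close>

lemma middle_minus_minus: "middle X (\<lambda>L. - e L) (\<lambda>L. - N L) = middle X e N"
  by (simp add: middle_def omega_def cleared_def[abs_def])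

lemma halved_cong:
  assumes "\<And>L. L \<in> X \<Longrightarrow> sgn (s L) = sgn (t L)"
  shows "halved X s \<longleftrightarrow> halved X t"
proof -
  have "s L < 0 \<longleftrightarrow> t L < 0" "0 < s L \<longleftrightarrow> 0 < t L" if "L \<in> X" for L
    using sgn_less[of "s L"] sgn_less[of "t L"] sgn_greater[of "s L"] sgn_greater[of "t L"]
    unfolding assms[OF that] by simp_all
  then have "{L \<in> X. s L < 0} = {L \<in> X. t L < 0}" "{L \<in> X. 0 < s L} = {L \<in> X. 0 < t L}"
    by auto
  then show ?thesis by (simp add: halved_def)
qed

text \<open>Multiplying the comparison of the middle with \<open>N L / e L\<close> by the square of
  \<open>e L\<close> avoids division and assigns 0 to a parallel line. If there is such a line, the
  middle is the median of the odd rest, so each side has fewer than half even of the rest.\<close>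

lemma halved_middle:
  assumes fin: "finite X" and even: "even (card X)"
    and one: "\<And>K L. K \<in> X \<Longrightarrow> L \<in> X \<Longrightarrow> e K = 0 \<Longrightarrow> e L = 0 \<Longrightarrow> K = L"
  shows "halved X (\<lambda>L. e L * (e L * middle X e N - N L))"
proof -
  have sgn: "sgn (e L * (e L * m - N L)) = sgn (m - N L / e L)" if "e L \<noteq> 0" for L m
  proof -
    have "e L * (e L * m - N L) = (e L)\<^sup>2 * (m - N L / e L)"
      using that by (simp add: field_simps power2_eq_square)
    moreover have "sgn ((e L)\<^sup>2) = 1" using that by (simp only: sgn_1_pos zero_less_power2) simp
    ultimately show ?thesis by (simp only: sgn_mult mult_1)
  qed
  show ?thesis
  proof (cases "\<exists>L\<in>X. e L = 0")
    case False
    then have "halved X (\<lambda>L. middle X e N - N L / e L)"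
      using fin by (intro halved_of_mean[OF fin even _ middle_weighted_mean[OF fin even]] omega_pos) auto
    then show ?thesis using False
      by (subst halved_cong[where t = "\<lambda>L. middle X e N - N L / e L"]) (auto intro: sgn)
  next
    case True
    then obtain L where L: "L \<in> X" "e L = 0" by auto
    have nz: "e K \<noteq> 0" if "K \<in> X - {L}" for K using one[OF _ L(1) _ L(2), of K] that by auto
    define m where "m = middle X e N"
    have m: "m = median (X - {L}) (\<lambda>J. N J / e J)"
      unfolding m_def by (rule middle_at_parallel[of X L e N, OF fin even L nz])
    have med: "is_median (X - {L}) (\<lambda>J. N J / e J) m"
      unfolding m using fin odd_card_remove[OF fin even L(1)] by (intro is_median_median) auto
    have "(e J * (e J * m - N J) < 0) = (m < N J / e J)" "(0 < e J * (e J * m - N J)) = (N J / e J < m)"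
      if "J \<in> X - {L}" for J
      using sgn_less[of "e J * (e J * m - N J)"] sgn_greater[of "e J * (e J * m - N J)"]
      unfolding sgn[OF nz[OF that]] by simp_all
    then have "{J \<in> X. e J * (e J * m - N J) < 0} = {J \<in> X - {L}. m < N J / e J}"
      "{J \<in> X. 0 < e J * (e J * m - N J)} = {J \<in> X - {L}. N J / e J < m}"
      using L(2) by (auto split: if_splits, (metis less_irrefl mult_zero_left)+)
    moreover have "card (X - {L}) < card X" using fin L(1) by (rule card_Diff1_less)
    ultimately show ?thesis using med unfolding halved_def is_median_def m_def by auto
  qed
qed

section \<open>The topological argument\<close>

text \<open>If \<open>h\<close> had no zero on the strip, then \<open>h = exp g\<close>, and \<open>g (\<theta>, pi/2) - g (\<theta>, -pi/2)\<close> would be a constant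
  odd multiple of \<open>\<i> pi\<close> by the first symmetry, and equal to its own negative by the second.\<close>

lemma common_zero_of_symmetric_map:
  fixes h :: "real \<Rightarrow> real \<Rightarrow> complex"
  assumes cont: "continuous_on UNIV (\<lambda>x. h (fst x) (snd x))"
    and odd: "\<And>\<theta> \<psi>. h \<theta> (\<psi> + pi) = - h \<theta> \<psi>"
    and flip: "\<And>\<theta> \<psi>. h (\<theta> + pi) (- \<psi>) = h \<theta> \<psi>"
  obtains \<theta> \<psi> where "- (pi/2) \<le> \<psi>" "\<psi> \<le> pi/2" "h \<theta> \<psi> = 0"
proof -
  let ?S = "UNIV \<times> {- (pi/2)..pi/2} :: (real \<times> real) set"
  have "\<exists>x\<in>?S. h (fst x) (snd x) = 0"
  proof (rule ccontr)
    assume "\<not> ?thesis"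
    then have nz: "\<And>x. x \<in> ?S \<Longrightarrow> h (fst x) (snd x) \<noteq> 0" by blast
    have contr: "contractible ?S"
      by (intro convex_imp_contractible convex_Times) auto
    have "continuous_on ?S (\<lambda>x. h (fst x) (snd x))"
      using cont by (rule continuous_on_subset) auto
    from continuous_logarithm_on_contractible[OF this contr nz]
    obtain g where g: "continuous_on ?S g"
        and hg: "\<And>x. x \<in> ?S \<Longrightarrow> h (fst x) (snd x) = exp (g x)"
      by auto
    \<comment> \<open>Two logarithms of the same number are equal or at least \<open>2 * pi\<close>
      apart, so a continuous choice on a connected set is constant.\<close>
    have const: "d a = d b" if "continuous_on S d" "connected S" "a \<in> S" "b \<in> S"
        "\<And>x. x \<in> S \<Longrightarrow> exp (d x) = w"
      for S and d :: "real \<Rightarrow> complex" and a b w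
    proof -
      have "d constant_on S"
      proof (rule continuous_discrete_range_constant[OF that(2,1)])
        fix x assume x: "x \<in> S"
        show "\<exists>e>0. \<forall>y. y \<in> S \<and> d y \<noteq> d x \<longrightarrow> e \<le> norm (d y - d x)"
        proof (intro exI[of _ "2*pi"] conjI allI impI)
          fix y assume y: "y \<in> S \<and> d y \<noteq> d x"
          then have "exp (d y) = exp (d x)" using that(5) x by simp
          then obtain n :: int where n: "d y = d x + (of_int (2*n) * pi) * \<i>"
            unfolding exp_eq by auto
          then have "n \<noteq> 0" using y by auto
          then have "1 \<le> \<bar>real_of_int n\<bar>" by linarith
          then show "2 * pi \<le> norm (d y - d x)"
            using n by (simp add: norm_mult)
        qed simp
      qed
      then show ?thesis using that(3,4) unfolding constant_on_def by metis
    qed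
    let ?D = "\<lambda>\<theta>. g (\<theta>, pi/2) - g (\<theta>, - (pi/2))"
    let ?E = "\<lambda>\<psi>. g (pi, \<psi>) - g (0, - \<psi>)"
    have expD: "exp (?D \<theta>) = -1" for \<theta>
    proof -
      have "exp (g (\<theta>, pi/2)) = - exp (g (\<theta>, - (pi/2)))"
        using hg[of "(\<theta>, pi/2)"] hg[of "(\<theta>, - (pi/2))"] odd[of \<theta> "- (pi/2)"] by simp
      then show ?thesis by (simp add: exp_diff)
    qed
    have "?D pi = ?D 0"
      by (rule const[of UNIV _ _ _ "-1"])
        (auto intro!: expD continuous_intros continuous_on_compose2[OF g])
    \<comment> \<open>Rearranged, this reads \<open>?D pi = - ?D 0\<close>. Together with
      \<open>?D pi = ?D 0\<close> it forces \<open>?D 0 = 0\<close>, although its exponential is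
      -1.\<close>
    moreover have "?E (pi/2) = ?E (- (pi/2))"
    proof (rule const[of "{- (pi/2)..pi/2}" _ _ _ "1"])
      fix \<psi> assume "\<psi> \<in> {- (pi/2)..pi/2}"
      then have "exp (g (pi, \<psi>)) = exp (g (0, - \<psi>))"
        using hg[of "(pi, \<psi>)"] hg[of "(0, -\<psi>)"] flip[of 0 "-\<psi>"] by simp
      then show "exp (?E \<psi>) = 1" by (simp add: exp_diff)
    qed (auto intro!: continuous_intros continuous_on_compose2[OF g])
    ultimately have "2 * ?D 0 = 0" by simp algebra
    then have "?D 0 = 0" by (metis mult_eq_0_iff zero_neq_numeral)
    then show False using expD[of 0] by simp
  qed
  then show ?thesis using that by auto
qed

text \<open>The differences of the middle of \<open>R\<close> from those of \<open>B\<close> and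
  \<open>G\<close> are the real and imaginary part of one complex function with the required
  symmetries. At its zero the three middles coincide, and \<open>v\<close> is their common
  value.\<close>

lemma exists_common_middle:
  fixes e :: "'a \<Rightarrow> real \<Rightarrow> real" and N :: "'a \<Rightarrow> real \<Rightarrow> real \<Rightarrow> real"
  assumes fin: "finite R" "finite B" "finite G"
    and even: "even (card R)" "even (card B)" "even (card G)"
    and e: "\<And>L. continuous_on UNIV (e L)"
    and N: "\<And>L. continuous_on UNIV (\<lambda>x. N L (fst x) (snd x))"
    and one: "\<And>\<theta> K L. K \<in> R \<union> B \<union> G \<Longrightarrow> L \<in> R \<union> B \<union> G \<Longrightarrow> e K \<theta> = 0 \<Longrightarrow> e L \<theta> = 0 \<Longrightarrow> K = L"
    and e_pi: "\<And>L \<theta>. e L (\<theta> + pi) = - e L \<theta>"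
    and N_pi: "\<And>L \<theta> \<psi>. N L \<theta> (\<psi> + pi) = - N L \<theta> \<psi>"
    and N_flip: "\<And>L \<theta> \<psi>. N L (\<theta> + pi) (- \<psi>) = - N L \<theta> \<psi>"
  obtains \<psi> \<theta> v where "- (pi/2) \<le> \<psi>" "\<psi> \<le> pi/2"
    "\<forall>X\<in>{R, B, G}. halved X (\<lambda>L. e L \<theta> * (e L \<theta> * v - N L \<theta> \<psi>))"
proof -
  define m where "m X \<theta> \<psi> = middle X (\<lambda>L. e L \<theta>) (\<lambda>L. N L \<theta> \<psi>)" for X \<theta> \<psi>
  have X: "finite X" "even (card X)" "X \<subseteq> R \<union> B \<union> G" if "X \<in> {R, B, G}" for X
    using that fin even by auto
  have cont: "continuous_on UNIV (\<lambda>x. m X (fst x) (snd x))" if "X \<in> {R, B, G}" for X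
    unfolding m_def
  proof (rule continuous_on_middle[OF X(1,2)[OF that]])
    show "K = L" if "K \<in> X" "L \<in> X" "e K (fst y) = 0" "e L (fst y) = 0" for y :: "real \<times> real" and K L
      using one[OF _ _ that(3,4)] X(3)[OF \<open>X \<in> _\<close>] that(1,2) by blast
    show "continuous_on UNIV (\<lambda>y::real \<times> real. e L (fst y))" for L
      by (intro continuous_on_compose2[OF e] continuous_intros) simp
  qed (rule N)
  have m_pi: "m X \<theta> (\<psi> + pi) = - m X \<theta> \<psi>" if "X \<in> {R, B, G}" for X \<theta> \<psi>
    unfolding m_def N_pi by (rule middle_minus[OF X(1,2)[OF that]])
  have m_flip: "m X (\<theta> + pi) (- \<psi>) = m X \<theta> \<psi>" for X \<theta> \<psi>
    unfolding m_def N_flip e_pi by (rule middle_minus_minus)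
  have c: "continuous_on UNIV (\<lambda>x. Complex (m R (fst x) (snd x) - m B (fst x) (snd x))
      (m R (fst x) (snd x) - m G (fst x) (snd x)))"
    unfolding Complex_eq by (intro continuous_intros cont) auto
  obtain \<theta> \<psi> where \<psi>: "- (pi/2) \<le> \<psi>" "\<psi> \<le> pi/2"
      and zero: "Complex (m R \<theta> \<psi> - m B \<theta> \<psi>) (m R \<theta> \<psi> - m G \<theta> \<psi>) = 0"
    by (rule common_zero_of_symmetric_map[OF c]) (simp_all add: m_pi m_flip complex_eq_iff)
  have eq: "m X \<theta> \<psi> = m R \<theta> \<psi>" if "X \<in> {R, B, G}" for X
    using that zero by (auto simp: complex_eq_iff)
  have "halved X (\<lambda>L. e L \<theta> * (e L \<theta> * m R \<theta> \<psi> - N L \<theta> \<psi>))" if "X \<in> {R, B, G}" for X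
    unfolding eq[OF that, symmetric] unfolding m_def
  proof (rule halved_middle[OF X(1,2)[OF that]])
    show "K = L" if "K \<in> X" "L \<in> X" "e K \<theta> = 0" "e L \<theta> = 0" for K L
      using one[OF _ _ that(3,4)] X(3)[OF \<open>X \<in> _\<close>] that(1,2) by blast
  qed
  then show ?thesis using that[OF \<psi>] by blast
qed

section \<open>Resolving ties\<close>

text \<open>Induction by adding the largest element \<open>b\<close>: for ranks up to
  \<open>card A\<close> the interval is first shortened to end at \<open>b\<close>, and for the top
  rank a point above \<open>b\<close> serves. Open intervals are infinite, so a finite set
  \<open>F\<close> can be avoided; it will hold the offsets of all lines, not only of those being
  ranked.\<close>

lemma exists_cut_at_rank:
  fixes S :: "real set"
  assumes "finite S" "finite F" "S \<subseteq> {lo<..<hi}" "lo < hi" "j \<le> card S"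
  shows "\<exists>v. lo < v \<and> v < hi \<and> v \<notin> F \<and> v \<notin> S \<and> card {x \<in> S. x < v} = j"
  using assms(1,3-)
proof (induction S arbitrary: hi j rule: finite_linorder_max_induct)
  case empty
  then have "infinite ({lo<..<hi} - F)" using assms(2) by (simp add: infinite_Ioo)
  then obtain v where "v \<in> {lo<..<hi} - F" by (metis finite.emptyI ex_in_conv)
  then show ?case using empty by auto
next
  case (insert b A)
  have b: "lo < b" "b < hi" "b \<notin> A" using insert.prems insert.hyps by auto
  show ?case
  proof (cases "j \<le> card A")
    case True
    have "A \<subseteq> {lo<..<b}" using insert.hyps insert.prems by auto
    from insert.IH[OF this b(1) True] obtain v where
      v: "lo < v" "v < b" "v \<notin> F" "v \<notin> A" "card {x \<in> A. x < v} = j" by blast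
    then have "{x \<in> insert b A. x < v} = {x \<in> A. x < v}" by auto
    then show ?thesis using v b by (intro exI[of _ v]) auto
  next
    case False
    then have j: "j = card (insert b A)" using insert.prems insert.hyps b by simp
    have "infinite ({b<..<hi} - F)" using assms(2) b by (simp add: infinite_Ioo)
    then obtain v where v: "v \<in> {b<..<hi} - F" by (metis finite.emptyI ex_in_conv)
    have "{x \<in> insert b A. x < v} = insert b A" using v insert.hyps by fastforce
    then show ?thesis using v b j insert.hyps by (intro exI[of _ v]) auto
  qed
qed

lemma exists_cut_at_rank_indexed:
  fixes b :: "'a \<Rightarrow> real"
  assumes "finite T" "inj_on b T" "finite F" "b ` T \<subseteq> {lo<..<hi}" "lo < hi" "j \<le> card T"
  obtains v where "lo < v" "v < hi" "v \<notin> F" "v \<notin> b ` T" "card {L \<in> T. b L < v} = j"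
proof -
  obtain v where v: "lo < v" "v < hi" "v \<notin> F" "v \<notin> b ` T" "card {x \<in> b ` T. x < v} = j"
    using exists_cut_at_rank[of "b ` T" F lo hi j] assms by (auto simp: card_image)
  have "{x \<in> b ` T. x < v} = b ` {L \<in> T. b L < v}" by auto
  moreover have "inj_on b {L \<in> T. b L < v}" using assms(2) by (rule inj_on_subset) auto
  ultimately show ?thesis using v that by (simp add: card_image)
qed

text \<open>\<open>P\<close> is the set of lines parallel to the plane.  A class containing such a line may fall one
  short of half, since the parallel line can still be moved to either side by rotating the plane.
  A class that is not yet halved accounts for at least two of the at most four tied or parallel lines.\<close>

lemma exists_common_cut:
  fixes a b :: "'a \<Rightarrow> real"
  assumes fin: "finite R" "finite B" "finite G"
    and disj: "R \<inter> B = {}" "R \<inter> G = {}" "B \<inter> G = {}"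
    and even: "\<And>X. X \<in> {R, B, G} \<Longrightarrow> even (card X)"
    and par: "P \<subseteq> R \<union> B \<union> G" "card P \<le> 1"
    and ties: "card {L \<in> R \<union> B \<union> G - P. a L = 0} \<le> 3"
    and s: "\<And>L. L \<in> P \<Longrightarrow> a L = 0"
    and halved: "\<And>X. X \<in> {R, B, G} \<Longrightarrow> halved X a"
    and inj: "inj_on b (R \<union> B \<union> G - P)"
    and r: "0 < r"
    and near: "\<And>L. L \<in> R \<union> B \<union> G - P \<Longrightarrow> a L = 0 \<Longrightarrow> \<bar>b L - m\<bar> < r"
    and below: "\<And>L. L \<in> R \<union> B \<union> G - P \<Longrightarrow> 0 < a L \<Longrightarrow> b L < m - r"
    and above: "\<And>L. L \<in> R \<union> B \<union> G - P \<Longrightarrow> a L < 0 \<Longrightarrow> m + r < b L"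
  obtains v where "\<forall>L\<in>R \<union> B \<union> G - P. b L \<noteq> v"
    "\<forall>X\<in>{R, B, G}. 2 * card {L \<in> X - P. v < b L} = card X \<or>
       X \<inter> P \<noteq> {} \<and> 2 * (card {L \<in> X - P. v < b L} + 1) = card X"
proof -
  let ?A = "R \<union> B \<union> G"
  \<comment> \<open>A negative \<open>a L\<close> means that the offset of \<open>L\<close> is above
    the cut, so \<open>Hi\<close> counts the lines above, \<open>Lo\<close> those below, and
    \<open>T\<close> collects the ties that are not parallel to the plane.\<close>
  define T where "T X = {L \<in> X - P. a L = 0}" for X
  define Hi where "Hi X = card {L \<in> X. a L < 0}" for X
  define Lo where "Lo X = card {L \<in> X. 0 < a L}" for X
  have X: "finite X" "X \<subseteq> ?A" if "X \<in> {R, B, G}" for X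
    using that fin by auto
  have finP: "finite P" using par(1) fin by (meson finite_Un finite_subset)
  have finT: "finite (T X)" if "X \<in> {R, B, G}" for X
    using X[OF that] by (simp add: T_def)
  have XY: "X \<inter> Y = {}" if "X \<in> {R, B, G}" "Y \<in> {R, B, G}" "X \<noteq> Y" for X Y
    using that disj by auto
  have total: "card X = Hi X + Lo X + card (T X) + card (X \<inter> P)" if x: "X \<in> {R, B, G}" for X
  proof -
    have "X = ({L \<in> X. a L < 0} \<union> {L \<in> X. 0 < a L}) \<union> (T X \<union> (X \<inter> P))"
      using s by (auto simp: T_def)
    moreover have "card (({L \<in> X. a L < 0} \<union> {L \<in> X. 0 < a L}) \<union> (T X \<union> (X \<inter> P))) =
        Hi X + Lo X + (card (T X) + card (X \<inter> P))"
      unfolding Hi_def Lo_def using X[OF x] s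
      by (subst card_Un_disjoint; (subst card_Un_disjoint)?; (subst card_Un_disjoint)?)
        (auto simp: T_def)
    ultimately show ?thesis by simp
  qed
  have ties2: "card (T X) + card (T Y) \<le> 3" if "X \<in> {R, B, G}" "Y \<in> {R, B, G}" "X \<noteq> Y" for X Y
  proof -
    have "card (T X) + card (T Y) = card (T X \<union> T Y)"
      using XY[OF that] finT that by (intro card_Un_disjoint[symmetric]) (auto simp: T_def)
    also have "\<dots> \<le> card {L \<in> ?A - P. a L = 0}"
      using X(2)[OF that(1)] X(2)[OF that(2)] fin by (intro card_mono) (auto simp: T_def)
    finally show ?thesis using ties by simp
  qed
  have par2: "card (X \<inter> P) + card (Y \<inter> P) \<le> 1" if "X \<in> {R, B, G}" "Y \<in> {R, B, G}" "X \<noteq> Y" for X Y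
  proof -
    have "card (X \<inter> P) + card (Y \<inter> P) = card ((X \<inter> P) \<union> (Y \<inter> P))"
      using XY[OF that] finP by (intro card_Un_disjoint[symmetric]) auto
    also have "\<dots> \<le> card P" using finP by (intro card_mono) auto
    finally show ?thesis using par(2) by simp
  qed
  have par1: "card (X \<inter> P) \<le> 1" for X
    using card_mono[OF finP, of "X \<inter> P"] par(2) by simp
  \<comment> \<open>For a cut inside the window around \<open>m\<close> the untied lines keep their
    sides, so only the ties are redistributed.\<close>
  have upper: "card {L \<in> X - P. v < b L} + card {L \<in> T X. b L < v} = Hi X + card (T X)"
    if x: "X \<in> {R, B, G}" and v: "m - r < v" "v < m + r" and nv: "\<And>L. L \<in> T X \<Longrightarrow> b L \<noteq> v" for X v
  proof -
    have mem: "L \<in> ?A - P" if "L \<in> X - P" for L using that X(2)[OF x] by blast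
    have eq: "{L \<in> X - P. v < b L} = {L \<in> X. a L < 0} \<union> {L \<in> T X. v < b L}"
    proof (intro set_eqI iffI)
      fix L assume L: "L \<in> {L \<in> X - P. v < b L}"
      then have "\<not> 0 < a L" using below[OF mem] v by fastforce
      then show "L \<in> {L \<in> X. a L < 0} \<union> {L \<in> T X. v < b L}" using L by (auto simp: T_def)
    next
      fix L assume L: "L \<in> {L \<in> X. a L < 0} \<union> {L \<in> T X. v < b L}"
      then have LP: "L \<in> X - P" using s by (auto simp: T_def)
      show "L \<in> {L \<in> X - P. v < b L}" using L LP above[OF mem[OF LP]] v by auto
    qed
    have "card {L \<in> X - P. v < b L} = Hi X + card {L \<in> T X. v < b L}"
      unfolding eq Hi_def using X(1)[OF x] finT[OF x] by (intro card_Un_disjoint) (auto simp: T_def)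
    moreover have "card (T X) = card {L \<in> T X. b L < v} + card {L \<in> T X. v < b L}"
    proof -
      have "{L \<in> T X. v \<le> b L} = {L \<in> T X. v < b L}" using nv by force
      then show ?thesis using card_less_plus_ge[OF finT[OF x], of b v] by simp
    qed
    ultimately show ?thesis by simp
  qed
  have below_le: "card {L \<in> T X. b L < v} \<le> card (T X)" if "X \<in> {R, B, G}" for X v
    using finT[OF that] by (intro card_mono) auto
  define good where "good X \<longleftrightarrow> 2 * Hi X = card X \<and> 2 * Lo X = card X" for X
  have bad: "2 * Hi X < card X" "2 * Lo X < card X" if "X \<in> {R, B, G}" "\<not> good X" for X
    using halved[OF that(1)] that(2) unfolding halved_def good_def Hi_def Lo_def by auto
  define ok where "ok X v \<longleftrightarrow> 2 * card {L \<in> X - P. v < b L} = card X \<or>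
       X \<inter> P \<noteq> {} \<and> 2 * (card {L \<in> X - P. v < b L} + 1) = card X" for X v
  have ok_good: "ok X v" if "X \<in> {R, B, G}" "m - r < v" "v < m + r" "\<And>L. L \<in> T X \<Longrightarrow> b L \<noteq> v" "good X" for X v
    using upper[OF that(1-4)] below_le[OF that(1), of v] total[OF that(1)] that(5)
    unfolding ok_def good_def by linarith
  have par_ne: "X \<inter> P \<noteq> {}" if "card (X \<inter> P) = 1" for X using that by force
  have cut: "\<exists>v. m - r < v \<and> v < m + r \<and> (\<forall>L\<in>?A - P. b L \<noteq> v) \<and> card {L \<in> T X. b L < v} = j"
    if x: "X \<in> {R, B, G}" and j: "j \<le> card (T X)" for X j
  proof -
    have inj': "inj_on b (T X)" using inj by (rule inj_on_subset) (use X(2)[OF x] in \<open>auto simp: T_def\<close>)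
    have im: "b ` T X \<subseteq> {m - r<..<m + r}"
      using near X(2)[OF x] by (fastforce simp: T_def abs_less_iff)
    have F: "finite (b ` (?A - P))" using fin by simp
    show ?thesis
      by (rule exists_cut_at_rank_indexed[OF finT[OF x] inj' F im _ j]) (use r in auto)
  qed
  have "\<exists>v. (\<forall>L\<in>?A - P. b L \<noteq> v) \<and> (\<forall>X\<in>{R, B, G}. ok X v)"
  proof (cases "\<exists>X\<in>{R, B, G}. \<not> good X")
    case False
    obtain v where v: "m - r < v" "v < m + r" "\<forall>L\<in>?A - P. b L \<noteq> v"
      using cut[of R 0] by auto
    have "ok X v" if "X \<in> {R, B, G}" for X
      using ok_good[OF that v(1,2)] v(3) False that X(2)[OF that] by (auto simp: T_def)
    then show ?thesis using v(3) by (intro exI[of _ v] conjI ballI) auto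
  next
    case True
    \<comment> \<open>The class \<open>X\<close> will be halved exactly by the choice of the cut.
      One without a parallel line is preferred, since a class with such a line may be left one
      short.\<close>
    then obtain X where x: "X \<in> {R, B, G}" "\<not> good X"
        and pref: "card (X \<inter> P) = 0 \<or> (\<forall>Y\<in>{R, B, G}. \<not> good Y \<longrightarrow> card (Y \<inter> P) \<noteq> 0)"
    proof (cases "\<exists>X\<in>{R, B, G}. \<not> good X \<and> card (X \<inter> P) = 0")
      case True
      then obtain X where X: "X \<in> {R, B, G}" "\<not> good X" "card (X \<inter> P) = 0"
        by (elim bexE conjE)
      show ?thesis by (rule that[OF X(1,2) disjI1[OF X(3)]])
    next
      case no: False
      from True obtain X where X: "X \<in> {R, B, G}" "\<not> good X" by (elim bexE)
      have "\<forall>Y\<in>{R, B, G}. \<not> good Y \<longrightarrow> card (Y \<inter> P) \<noteq> 0" using no by (simp add: imp_conv_disj)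
      then show ?thesis by (rule that[OF X disjI2])
    qed
    obtain h where h: "card X = 2 * h" using even[OF x(1)] by (rule evenE)
    have HLX: "Hi X < h" "Lo X < h" using bad[OF x] unfolding h by simp_all
    \<comment> \<open>This many ties must go below the cut to leave exactly \<open>h\<close> lines
      above. The subtraction does not truncate, because \<open>Lo X < h\<close> and at most one line
      of \<open>X\<close> is parallel.\<close>
    define j where "j = Hi X + card (T X) - h"
    have j: "j + h = Hi X + card (T X)" "j \<le> card (T X)"
      using HLX total[OF x(1)] par1[of X] h unfolding j_def by linarith+
    obtain v where v: "m - r < v" "v < m + r" "\<forall>L\<in>?A - P. b L \<noteq> v" "card {L \<in> T X. b L < v} = j"
      using cut[OF x(1) j(2)] by (elim exE conjE)
    have nv: "b L \<noteq> v" if "Y \<in> {R, B, G}" "L \<in> T Y" for L Y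
      using v(3) that X(2)[OF that(1)] by (auto simp: T_def)
    have "ok Y v" if y: "Y \<in> {R, B, G}" for Y
    proof (cases "Y = X")
      case True
      have "card {L \<in> X - P. v < b L} = h"
        using upper[OF x(1) v(1,2) nv[OF x(1)]] v(4) j by linarith
      then show ?thesis using True h by (simp add: ok_def)
    next
      case ne: False
      show ?thesis
      proof (cases "good Y")
        case True
        then show ?thesis using ok_good[OF y v(1,2) nv[OF y]] by blast
      next
        case False
        obtain k where k: "card Y = 2 * k" using even[OF y] by (rule evenE)
        have HLY: "Hi Y < k" "Lo Y < k" using bad[OF y False] unfolding k by simp_all
        \<comment> \<open>If \<open>X\<close> contained a parallel line, the preference in its
          choice would give \<open>Y\<close> one too, but there is at most one in all.\<close>
        have "card (X \<inter> P) = 0"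
          using pref
        proof
          assume "\<forall>Y\<in>{R, B, G}. \<not> good Y \<longrightarrow> card (Y \<inter> P) \<noteq> 0"
          note * = this[rule_format]
          have "card (X \<inter> P) \<noteq> 0" "card (Y \<inter> P) \<noteq> 0" using *[OF x] *[OF y False] .
          then show ?thesis using par2[OF x(1) y ne[symmetric]] by linarith
        qed
        \<comment> \<open>\<open>X\<close> takes at least two of the three ties, so at most one is
          left for \<open>Y\<close>. Since \<open>Y\<close> also has at least two tied or parallel
          lines, it has one of each, and \<open>Hi Y = k - 1\<close>. If its tie falls above the
          cut, \<open>Y\<close> is halved; if below, it is one short and the parallel line can make
          up for it.\<close>
        then have "2 \<le> card (T X)" using HLX total[OF x(1)] h by linarith
        then have "card (T Y) \<le> 1" using ties2[OF x(1) y ne[symmetric]] by linarith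
        moreover have "2 \<le> card (T Y) + card (Y \<inter> P)" using HLY total[OF y] k by linarith
        ultimately have tp: "card (T Y) = 1" "card (Y \<inter> P) = 1" using par1[of Y] by linarith+
        then have "Hi Y + 1 = k" using HLY total[OF y] k by arith
        then have "2 * (Hi Y + 1) = card Y" using k by simp
        then show ?thesis
          using upper[OF y v(1,2) nv[OF y]] below_le[OF y, of v] tp par_ne[OF tp(2)]
          unfolding ok_def by (cases "card {L \<in> T Y. b L < v} = 0") auto
      qed
    qed
    then show ?thesis using v(3) by (intro exI[of _ v] conjI ballI) auto
  qed
  then obtain v where v: "\<forall>L\<in>?A - P. b L \<noteq> v" "\<forall>X\<in>{R, B, G}. ok X v"
    by (elim exE conjE)
  show ?thesis by (rule that[OF v(1) v(2)[unfolded ok_def]])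
qed

text \<open>For the line \<open>p + s d\<close> and the vertical plane with direction \<open>u = (cos \<theta>, sin \<theta>)\<close> at signed distance
  \<open>\<eta>\<close> from the z-axis, \<open>hor / den\<close> and \<open>ver / den\<close> are the coordinates, along \<open>u\<close> and vertically, of
  their common point, and \<open>num / den\<close> is its offset from the line through the plane's origin with
  slope angle \<open>\<psi>\<close>.  The sign of \<open>side\<close> compares this offset with \<open>v\<close>; it is 0 if the line is parallel
  to the plane.\<close>

definition den :: "real^3 \<Rightarrow> real \<Rightarrow> real" where
  "den d \<theta> = cos \<theta> * d$2 - sin \<theta> * d$1"

definition hor :: "real^3 \<Rightarrow> real^3 \<Rightarrow> real \<Rightarrow> real \<Rightarrow> real" where
  "hor p d \<eta> \<theta> = p$1 * d$2 - p$2 * d$1 + \<eta> * (sin \<theta> * d$2 + cos \<theta> * d$1)"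

definition ver :: "real^3 \<Rightarrow> real^3 \<Rightarrow> real \<Rightarrow> real \<Rightarrow> real" where
  "ver p d \<eta> \<theta> = p$3 * den d \<theta> - d$3 * (cos \<theta> * p$2 - sin \<theta> * p$1 - \<eta>)"

definition num :: "real^3 \<Rightarrow> real^3 \<Rightarrow> real \<Rightarrow> real \<Rightarrow> real \<Rightarrow> real" where
  "num p d \<eta> \<theta> \<psi> = cos \<psi> * ver p d \<eta> \<theta> - sin \<psi> * hor p d \<eta> \<theta>"

definition side :: "real^3 \<Rightarrow> real^3 \<Rightarrow> real \<Rightarrow> real \<Rightarrow> real \<Rightarrow> real \<Rightarrow> real" where
  "side p d \<eta> \<theta> \<psi> v = den d \<theta> * (den d \<theta> * v - num p d \<eta> \<theta> \<psi>)"

section \<open>Generic shift and slope, and rotation past a parallel line\<close>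

lemma eventually_affine_nonzero:
  fixes a b :: real
  assumes "b \<noteq> 0"
  shows "\<forall>\<^sub>F x in at x0. a + x * b \<noteq> 0"
  using eventually_neq_at_within[of "- a / b" x0 UNIV]
  by eventually_elim (use assms in \<open>auto simp: field_simps\<close>)

text \<open>The cosine is positive on the open interval, so a zero would satisfy
  \<open>tan x = a / b\<close>, whose only solution there is \<open>arctan (a / b)\<close>.\<close>

lemma eventually_cos_sin_nonzero:
  assumes "b \<noteq> 0"
  shows "\<forall>\<^sub>F x in at \<psi> within {- (pi/2)<..<pi/2}. cos x * a - sin x * b \<noteq> 0"
proof -
  have "\<forall>\<^sub>F x in at \<psi> within {- (pi/2)<..<pi/2}. x \<in> {- (pi/2)<..<pi/2}"
    by (simp add: eventually_at_filter)
  then show ?thesis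
    using eventually_neq_at_within[of "arctan (a/b)" \<psi> "{- (pi/2)<..<pi/2}"]
  proof eventually_elim
    case (elim x)
    then have "0 < cos x" by (intro cos_gt_zero_pi) auto
    moreover have "tan x \<noteq> a / b" using elim arctan_tan[of x] by auto
    ultimately show ?case using assms by (auto simp: tan_def field_simps)
  qed
qed

text \<open>The shift \<eta> comes first and makes the horizontal coordinates of the intersection
  points distinct; then two points have equal offsets for only one slope angle in the open interval.
  Each condition holds in a punctured neighbourhood, so finitely many of them hold together
  arbitrarily close to the old plane and slope. The last conclusion prepares the rotation past a
  parallel line.\<close>

lemma exists_generic_perturbation:
  fixes p d :: "'a \<Rightarrow> real^3"
  assumes fin: "finite A"
    and cross: "\<And>K L. K \<in> A \<Longrightarrow> L \<in> A \<Longrightarrow> K \<noteq> L \<Longrightarrow> d K$1 * d L$2 - d K$2 * d L$1 \<noteq> 0"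
    and nonvert: "\<And>L. L \<in> A \<Longrightarrow> d L$1 \<noteq> 0 \<or> d L$2 \<noteq> 0"
    and r: "0 < r" and \<psi>: "- (pi/2) \<le> \<psi>" "\<psi> \<le> pi/2"
  obtains \<psi>' \<eta> where "- (pi/2) < \<psi>'" "\<psi>' < pi/2"
    "inj_on (\<lambda>L. num (p L) (d L) \<eta> \<theta> \<psi>' / den (d L) \<theta>) {L \<in> A. den (d L) \<theta> \<noteq> 0}"
    "\<forall>L\<in>A. den (d L) \<theta> \<noteq> 0 \<longrightarrow>
      \<bar>num (p L) (d L) \<eta> \<theta> \<psi>' / den (d L) \<theta> - num (p L) (d L) 0 \<theta> \<psi> / den (d L) \<theta>\<bar> < r"
    "\<forall>L\<in>A. den (d L) \<theta> = 0 \<longrightarrow> num (p L) (d L) \<eta> \<theta> \<psi>' \<noteq> 0"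
proof -
  define V where "V L \<eta> \<psi>' = num (p L) (d L) \<eta> \<theta> \<psi>' / den (d L) \<theta>" for L \<eta> \<psi>'
  let ?A = "{L \<in> A. den (d L) \<theta> \<noteq> 0}"
  have pyth: "cos \<theta> * cos \<theta> = 1 - sin \<theta> * sin \<theta>"
    using sin_cos_squared_add[of \<theta>] by (simp add: power2_eq_square)
  have "\<forall>\<^sub>F \<eta> in at 0. hor (p K) (d K) \<eta> \<theta> / den (d K) \<theta> \<noteq> hor (p L) (d L) \<eta> \<theta> / den (d L) \<theta>"
    if "K \<in> ?A" "L \<in> ?A" "K \<noteq> L" for K L
  proof -
    let ?b = "(sin \<theta> * d K$2 + cos \<theta> * d K$1) * den (d L) \<theta> - (sin \<theta> * d L$2 + cos \<theta> * d L$1) * den (d K) \<theta>"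
    \<comment> \<open>With denominators cleared, the difference of the horizontal coordinates is
      affine in \<eta>, and its coefficient is the determinant of the projected directions.\<close>
    have "?b = d K$1 * d L$2 - d K$2 * d L$1"
      using pyth unfolding den_def by algebra
    then have "?b \<noteq> 0" using cross that by simp
    from eventually_affine_nonzero[OF this,
        of "hor (p K) (d K) 0 \<theta> * den (d L) \<theta> - hor (p L) (d L) 0 \<theta> * den (d K) \<theta>" 0]
    show ?thesis
      by eventually_elim (use that in \<open>auto simp: hor_def field_simps\<close>)
  qed
  then have "\<forall>\<^sub>F \<eta> in at 0. \<forall>K\<in>?A. \<forall>L\<in>?A. K \<noteq> L \<longrightarrow>
      hor (p K) (d K) \<eta> \<theta> / den (d K) \<theta> \<noteq> hor (p L) (d L) \<eta> \<theta> / den (d L) \<theta>"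
    using fin by (intro eventually_ball_finite ballI) (auto simp: eventually_const_iff)
  moreover have "\<forall>\<^sub>F \<eta> in at 0. \<forall>L\<in>{L \<in> A. den (d L) \<theta> = 0}. hor (p L) (d L) \<eta> \<theta> \<noteq> 0"
  proof (intro eventually_ball_finite ballI)
    fix L assume L: "L \<in> {L \<in> A. den (d L) \<theta> = 0}"
    have "(sin \<theta> * d L$2 + cos \<theta> * d L$1)\<^sup>2 + (den (d L) \<theta>)\<^sup>2 = (d L$1)\<^sup>2 + (d L$2)\<^sup>2"
      using pyth unfolding den_def by algebra
    moreover have "(d L$1)\<^sup>2 + (d L$2)\<^sup>2 \<noteq> 0" using nonvert L by (simp add: sum_power2_eq_zero_iff)
    ultimately have "sin \<theta> * d L$2 + cos \<theta> * d L$1 \<noteq> 0" using L by auto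
    then show "\<forall>\<^sub>F \<eta> in at 0. hor (p L) (d L) \<eta> \<theta> \<noteq> 0"
      unfolding hor_def by (rule eventually_affine_nonzero)
  qed (use fin in simp)
  \<comment> \<open>Half of the allowed error \<open>r\<close> is spent on the shift, the other half
    below on the slope.\<close>
  moreover have "\<forall>\<^sub>F \<eta> in at 0. \<forall>L\<in>?A. dist (V L \<eta> \<psi>) (V L 0 \<psi>) < r/2"
  proof (intro eventually_ball_finite ballI tendstoD)
    fix L assume "L \<in> ?A"
    then show "((\<lambda>\<eta>. V L \<eta> \<psi>) \<longlongrightarrow> V L 0 \<psi>) (at 0)"
      unfolding V_def num_def ver_def hor_def by (intro tendsto_intros) auto
  qed (use fin r in auto)
  ultimately have "\<forall>\<^sub>F \<eta> in at (0::real).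
      (\<forall>K\<in>?A. \<forall>L\<in>?A. K \<noteq> L \<longrightarrow>
        hor (p K) (d K) \<eta> \<theta> / den (d K) \<theta> \<noteq> hor (p L) (d L) \<eta> \<theta> / den (d L) \<theta>) \<and>
      (\<forall>L\<in>{L \<in> A. den (d L) \<theta> = 0}. hor (p L) (d L) \<eta> \<theta> \<noteq> 0) \<and>
      (\<forall>L\<in>?A. dist (V L \<eta> \<psi>) (V L 0 \<psi>) < r/2)"
    by eventually_elim auto
  from eventually_happens'[OF trivial_limit_at this] obtain \<eta>
    where "\<forall>K\<in>?A. \<forall>L\<in>?A. K \<noteq> L \<longrightarrow>
        hor (p K) (d K) \<eta> \<theta> / den (d K) \<theta> \<noteq> hor (p L) (d L) \<eta> \<theta> / den (d L) \<theta>"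
      and "\<forall>L\<in>{L \<in> A. den (d L) \<theta> = 0}. hor (p L) (d L) \<eta> \<theta> \<noteq> 0"
      and "\<forall>L\<in>?A. dist (V L \<eta> \<psi>) (V L 0 \<psi>) < r/2" by (elim exE conjE)
  then have \<eta>1: "\<And>K L. K \<in> ?A \<Longrightarrow> L \<in> ?A \<Longrightarrow> K \<noteq> L \<Longrightarrow>
        hor (p K) (d K) \<eta> \<theta> / den (d K) \<theta> \<noteq> hor (p L) (d L) \<eta> \<theta> / den (d L) \<theta>"
      and \<eta>2: "\<And>L. L \<in> A \<Longrightarrow> den (d L) \<theta> = 0 \<Longrightarrow> hor (p L) (d L) \<eta> \<theta> \<noteq> 0"
      and \<eta>3: "\<And>L. L \<in> ?A \<Longrightarrow> dist (V L \<eta> \<psi>) (V L 0 \<psi>) < r/2" by simp_all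
  \<comment> \<open>Approaching \<psi> from within the open interval makes the new line non-vertical
    even if \<psi> is an end point.\<close>
  let ?F = "at \<psi> within {- (pi/2)<..<pi/2}"
  have "\<forall>\<^sub>F x in ?F. V K \<eta> x \<noteq> V L \<eta> x" if "K \<in> ?A" "L \<in> ?A" "K \<noteq> L" for K L
  proof -
    have "hor (p K) (d K) \<eta> \<theta> / den (d K) \<theta> - hor (p L) (d L) \<eta> \<theta> / den (d L) \<theta> \<noteq> 0"
      using \<eta>1[OF that] by simp
    from eventually_cos_sin_nonzero[OF this,
        of "ver (p K) (d K) \<eta> \<theta> / den (d K) \<theta> - ver (p L) (d L) \<eta> \<theta> / den (d L) \<theta>" \<psi>]
    show ?thesis
      by eventually_elim (auto simp: V_def num_def diff_divide_distrib algebra_simps)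
  qed
  then have "\<forall>\<^sub>F x in ?F. \<forall>K\<in>?A. \<forall>L\<in>?A. K \<noteq> L \<longrightarrow> V K \<eta> x \<noteq> V L \<eta> x"
    using fin by (intro eventually_ball_finite ballI) (auto simp: eventually_const_iff)
  moreover have "\<forall>\<^sub>F x in ?F. \<forall>L\<in>{L \<in> A. den (d L) \<theta> = 0}. num (p L) (d L) \<eta> \<theta> x \<noteq> 0"
    using fin \<eta>2 unfolding num_def
    by (intro eventually_ball_finite ballI eventually_cos_sin_nonzero) auto
  moreover have "\<forall>\<^sub>F x in ?F. \<forall>L\<in>?A. dist (V L \<eta> x) (V L \<eta> \<psi>) < r/2"
  proof (intro eventually_ball_finite ballI tendstoD)
    fix L assume "L \<in> ?A"
    then show "((\<lambda>x. V L \<eta> x) \<longlongrightarrow> V L \<eta> \<psi>) ?F"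
      unfolding V_def num_def by (intro tendsto_intros) auto
  qed (use fin r in auto)
  moreover have "\<forall>\<^sub>F x in ?F. x \<in> {- (pi/2)<..<pi/2}"
    by (simp add: eventually_at_filter)
  ultimately have ev: "\<forall>\<^sub>F x in ?F.
      (\<forall>K\<in>?A. \<forall>L\<in>?A. K \<noteq> L \<longrightarrow> V K \<eta> x \<noteq> V L \<eta> x) \<and>
      (\<forall>L\<in>{L \<in> A. den (d L) \<theta> = 0}. num (p L) (d L) \<eta> \<theta> x \<noteq> 0) \<and>
      (\<forall>L\<in>?A. dist (V L \<eta> x) (V L \<eta> \<psi>) < r/2) \<and> x \<in> {- (pi/2)<..<pi/2}"
    by eventually_elim auto
  have "\<psi> islimpt {- (pi/2)<..<pi/2}"
  proof -
    consider "\<psi> = - (pi/2)" | "\<psi> = pi/2" | "\<psi> \<in> interior {- (pi/2)<..<pi/2}"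
      using \<psi> by (fastforce simp: interior_open)
    then show ?thesis
    proof cases
      case 1
      show ?thesis unfolding 1 by (rule islimpt_greaterThanLessThan1) simp
    next
      case 2
      show ?thesis unfolding 2 by (rule islimpt_greaterThanLessThan2) simp
    next
      case 3
      then show ?thesis by (rule interior_limit_point)
    qed
  qed
  then have "?F \<noteq> bot" by (simp add: trivial_limit_within)
  from eventually_happens'[OF this ev] obtain x
    where "\<forall>K\<in>?A. \<forall>L\<in>?A. K \<noteq> L \<longrightarrow> V K \<eta> x \<noteq> V L \<eta> x"
      "\<forall>L\<in>{L \<in> A. den (d L) \<theta> = 0}. num (p L) (d L) \<eta> \<theta> x \<noteq> 0"
      "\<forall>L\<in>?A. dist (V L \<eta> x) (V L \<eta> \<psi>) < r/2" "x \<in> {- (pi/2)<..<pi/2}"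
    by (elim exE conjE)
  then have x: "\<And>K L. K \<in> ?A \<Longrightarrow> L \<in> ?A \<Longrightarrow> K \<noteq> L \<Longrightarrow> V K \<eta> x \<noteq> V L \<eta> x"
      "\<And>L. L \<in> A \<Longrightarrow> den (d L) \<theta> = 0 \<Longrightarrow> num (p L) (d L) \<eta> \<theta> x \<noteq> 0"
      "\<And>L. L \<in> ?A \<Longrightarrow> dist (V L \<eta> x) (V L \<eta> \<psi>) < r/2" "x \<in> {- (pi/2)<..<pi/2}"
    by simp_all
  show ?thesis
  proof (rule that[of x \<eta>])
    show "inj_on (\<lambda>L. num (p L) (d L) \<eta> \<theta> x / den (d L) \<theta>) ?A"
      using x(1) unfolding inj_on_def V_def by blast
    show "\<forall>L\<in>A. den (d L) \<theta> = 0 \<longrightarrow> num (p L) (d L) \<eta> \<theta> x \<noteq> 0"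
      using x(2) by simp
    show "\<forall>L\<in>A. den (d L) \<theta> \<noteq> 0 \<longrightarrow>
      \<bar>num (p L) (d L) \<eta> \<theta> x / den (d L) \<theta> - num (p L) (d L) 0 \<theta> \<psi> / den (d L) \<theta>\<bar> < r"
    proof (intro ballI impI)
      fix L assume L: "L \<in> A" and "den (d L) \<theta> \<noteq> 0"
      then have "L \<in> ?A" using L by simp
      then have "\<bar>V L \<eta> x - V L 0 \<psi>\<bar> < r"
        using x(3)[of L] \<eta>3[of L] unfolding dist_real_def by linarith
      then show "\<bar>num (p L) (d L) \<eta> \<theta> x / den (d L) \<theta> - num (p L) (d L) 0 \<theta> \<psi> / den (d L) \<theta>\<bar> < r"
        unfolding V_def .
    qed
  qed (use x(4) in auto)
qed

lemma eventually_sgn_eq: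
  fixes f :: "'a \<Rightarrow> real"
  assumes "(f \<longlongrightarrow> l) F" "l \<noteq> 0"
  shows "\<forall>\<^sub>F x in F. sgn (f x) = sgn l"
proof (cases "0 < l")
  case True
  then show ?thesis using order_tendstoD(1)[OF assms(1), of 0] by (auto elim: eventually_mono)
next
  case False
  then have "l < 0" using assms(2) by simp
  then show ?thesis using order_tendstoD(2)[OF assms(1), of 0] by (auto elim: eventually_mono)
qed

lemma tendsto_side:
  "((\<lambda>t. den d t * v - num p d \<eta> t \<psi>) \<longlongrightarrow> den d \<theta> * v - num p d \<eta> \<theta> \<psi>) (at \<theta>)"
  "((\<lambda>t. side p d \<eta> t \<psi> v) \<longlongrightarrow> side p d \<eta> \<theta> \<psi> v) (at \<theta>)"
  unfolding side_def num_def ver_def hor_def den_def by (intro tendsto_intros)+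

text \<open>Small rotations preserve the nonzero signs of the other lines. For the parallel line,
  \<open>den\<close> changes sign at \<theta> while \<open>num\<close> stays near a nonzero value,
  so \<open>side\<close> takes opposite signs for angles just before and just after
  \<theta>.\<close>

lemma exists_tilt:
  fixes p d :: "'a \<Rightarrow> real^3"
  assumes fin: "finite A"
    and one: "\<And>K L. K \<in> A \<Longrightarrow> L \<in> A \<Longrightarrow> den (d K) \<theta> = 0 \<Longrightarrow> den (d L) \<theta> = 0 \<Longrightarrow> K = L"
    and nonvert: "\<And>L. L \<in> A \<Longrightarrow> d L$1 \<noteq> 0 \<or> d L$2 \<noteq> 0"
    and side: "\<And>L. L \<in> A \<Longrightarrow> den (d L) \<theta> \<noteq> 0 \<Longrightarrow> side (p L) (d L) \<eta> \<theta> \<psi> v \<noteq> 0"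
    and num: "\<And>L. L \<in> A \<Longrightarrow> den (d L) \<theta> = 0 \<Longrightarrow> num (p L) (d L) \<eta> \<theta> \<psi> \<noteq> 0"
  obtains \<theta>' where
    "\<forall>L\<in>A. den (d L) \<theta> \<noteq> 0 \<longrightarrow>
      sgn (side (p L) (d L) \<eta> \<theta>' \<psi> v) = sgn (side (p L) (d L) \<eta> \<theta> \<psi> v)"
    "\<forall>L\<in>A. den (d L) \<theta> = 0 \<longrightarrow>
      sgn (side (p L) (d L) \<eta> \<theta>' \<psi> v) = (if below then -1 else 1)"
proof -
  have near: "\<forall>\<^sub>F t in at \<theta>. \<forall>L\<in>{L \<in> A. den (d L) \<theta> \<noteq> 0}.
      sgn (side (p L) (d L) \<eta> t \<psi> v) = sgn (side (p L) (d L) \<eta> \<theta> \<psi> v)"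
    using fin side by (intro eventually_ball_finite ballI eventually_sgn_eq tendsto_side(2)) auto
  show ?thesis
  proof (cases "\<exists>L\<in>A. den (d L) \<theta> = 0")
    case False
    then show ?thesis using that[of \<theta>] by blast
  next
    case True
    then obtain M where M: "M \<in> A" "den (d M) \<theta> = 0" by blast
    define s where "s = sin \<theta> * d M$2 + cos \<theta> * d M$1"
    have pyth: "cos \<theta> * cos \<theta> = 1 - sin \<theta> * sin \<theta>"
      using sin_cos_squared_add[of \<theta>] by (simp add: power2_eq_square)
    have "s\<^sup>2 + (den (d M) \<theta>)\<^sup>2 = (d M$1)\<^sup>2 + (d M$2)\<^sup>2"
      using pyth unfolding den_def s_def by algebra
    moreover have "(d M$1)\<^sup>2 + (d M$2)\<^sup>2 \<noteq> 0"
      using nonvert[OF M(1)] by (simp add: sum_power2_eq_zero_iff)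
    ultimately have s: "s \<noteq> 0" using M(2) by auto
    have den: "den (d M) t = - s * sin (t - \<theta>)" for t
    proof -
      have "den (d M) t + s * sin (t - \<theta>) = cos (t - \<theta>) * den (d M) \<theta>"
        unfolding den_def s_def sin_diff cos_diff using pyth by algebra
      then show ?thesis using M(2) by simp
    qed
    have lim: "\<forall>\<^sub>F t in at \<theta>. sgn (den (d M) t * v - num (p M) (d M) \<eta> t \<psi>) = - sgn (num (p M) (d M) \<eta> \<theta> \<psi>)"
      using eventually_sgn_eq[OF tendsto_side(1)[of "d M" v "p M" \<eta> \<psi> \<theta>]] num[OF M] M(2)
      by (simp add: sgn_minus)
    \<comment> \<open>Near \<theta> the sign of \<open>side\<close> is that of
      \<open>- den * num\<close>, that is of \<open>s * sin (t - \<theta>) * num\<close>: it is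
      \<open>c\<close> to the right of \<theta> and \<open>- c\<close> to the left.\<close>
    define c where "c = sgn s * sgn (num (p M) (d M) \<eta> \<theta> \<psi>)"
    have c: "c = 1 \<or> c = -1" using s num[OF M] by (auto simp: c_def sgn_if)
    have right: "\<forall>\<^sub>F t in at_right \<theta>. sgn (side (p M) (d M) \<eta> t \<psi> v) = c"
    proof -
      have "\<forall>\<^sub>F t in at_right \<theta>. t \<in> {\<theta><..<\<theta> + pi}"
        by (rule eventually_at_right_real) simp
      moreover have "\<forall>\<^sub>F t in at_right \<theta>. sgn (den (d M) t * v - num (p M) (d M) \<eta> t \<psi>) = - sgn (num (p M) (d M) \<eta> \<theta> \<psi>)"
        using lim by (simp add: eventually_at_split)
      ultimately show ?thesis
      proof eventually_elim
        case (elim t)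
        then have "0 < sin (t - \<theta>)" by (intro sin_gt_zero) auto
        then show ?case using elim unfolding side_def c_def by (simp add: den sgn_mult sgn_minus)
      qed
    qed
    have left: "\<forall>\<^sub>F t in at_left \<theta>. sgn (side (p M) (d M) \<eta> t \<psi> v) = - c"
    proof -
      have "\<forall>\<^sub>F t in at_left \<theta>. t \<in> {\<theta> - pi<..<\<theta>}"
        by (rule eventually_at_left_real) simp
      moreover have "\<forall>\<^sub>F t in at_left \<theta>. sgn (den (d M) t * v - num (p M) (d M) \<eta> t \<psi>) = - sgn (num (p M) (d M) \<eta> \<theta> \<psi>)"
        using lim by (simp add: eventually_at_split)
      ultimately show ?thesis
      proof eventually_elim
        case (elim t)
        then have "sin (t - \<theta>) < 0" using sin_gt_zero[of "\<theta> - t"] sin_minus[of "\<theta> - t"] by simp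
        then show ?case using elim unfolding side_def c_def by (simp add: den sgn_mult sgn_minus)
      qed
    qed
    have "\<exists>t. (\<forall>L\<in>{L \<in> A. den (d L) \<theta> \<noteq> 0}.
        sgn (side (p L) (d L) \<eta> t \<psi> v) = sgn (side (p L) (d L) \<eta> \<theta> \<psi> v)) \<and>
        sgn (side (p M) (d M) \<eta> t \<psi> v) = (if below then -1 else 1)"
    proof (cases "c = (if below then -1 else 1)")
      case True
      have "\<forall>\<^sub>F t in at_right \<theta>. \<forall>L\<in>{L \<in> A. den (d L) \<theta> \<noteq> 0}.
        sgn (side (p L) (d L) \<eta> t \<psi> v) = sgn (side (p L) (d L) \<eta> \<theta> \<psi> v)"
        using near by (simp add: eventually_at_split)
      from eventually_happens[OF eventually_conj[OF this right]] show ?thesis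
        using True by auto
    next
      case False
      then have c': "- c = (if below then -1 else 1)" using c by (auto split: if_splits)
      have "\<forall>\<^sub>F t in at_left \<theta>. \<forall>L\<in>{L \<in> A. den (d L) \<theta> \<noteq> 0}.
        sgn (side (p L) (d L) \<eta> t \<psi> v) = sgn (side (p L) (d L) \<eta> \<theta> \<psi> v)"
        using near by (simp add: eventually_at_split)
      from eventually_happens[OF eventually_conj[OF this left]] show ?thesis
        unfolding c' by auto
    qed
    then obtain t where t: "\<forall>L\<in>{L \<in> A. den (d L) \<theta> \<noteq> 0}.
        sgn (side (p L) (d L) \<eta> t \<psi> v) = sgn (side (p L) (d L) \<eta> \<theta> \<psi> v)"
        "sgn (side (p M) (d M) \<eta> t \<psi> v) = (if below then -1 else 1)" by (elim exE conjE)
    show ?thesis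
    proof (rule that[of t])
      show "\<forall>L\<in>A. den (d L) \<theta> = 0 \<longrightarrow>
          sgn (side (p L) (d L) \<eta> t \<psi> v) = (if below then -1 else 1)"
      proof (intro ballI impI)
        fix L assume "L \<in> A" "den (d L) \<theta> = 0"
        then have "L = M" using one M by blast
        then show "sgn (side (p L) (d L) \<eta> t \<psi> v) = (if below then -1 else 1)" using t(2) by simp
      qed
    qed (use t(1) in simp)
  qed
qed

section \<open>Lines in space\<close>

definition param_line :: "real^3 \<Rightarrow> real^3 \<Rightarrow> (real^3) set" where
  "param_line p d = range (\<lambda>s. p + s *\<^sub>R d)"

definition vline :: "real \<Rightarrow> real \<Rightarrow> (real^3) set" where
  "vline a b = {x. x$1 = a \<and> x$2 = b}"

lemma affine_hull_eq_param_line: "affine hull {p, q} = param_line p (q - p)"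
  unfolding param_line_def affine_hull_2_alt ..

lemma is_line_param_line:
  assumes "d \<noteq> 0"
  shows "is_line (param_line p d)"
  using assms affine_hull_eq_param_line[of p "p + d"] affine_affine_hull[of "{p, p + d}"]
    aff_dim_affine_hull[of "{p, p + d}"] aff_dim_2[of p "p + d"]
  by (simp add: is_line_def)

lemma is_line_imp_param_line:
  assumes "is_line L"
  obtains p d where "d \<noteq> 0" "L = param_line p d"
proof -
  have L: "affine L" "aff_dim L = 1" using assms by (auto simp: is_line_def)
  then obtain p where p: "p \<in> L" by fastforce
  have "L \<noteq> {p}" using L by auto
  then obtain q where q: "q \<in> L" "q \<noteq> p" using p by auto
  have "affine hull {p, q} = L"
    using L p q aff_dim_2[of p q]
    by (intro affine_dim_equal) (auto simp: hull_minimal)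
  then show ?thesis using that[of "q - p" p] q by (simp add: affine_hull_eq_param_line)
qed

lemma z_axis_eq: "z_axis = vline 0 0"
  by (simp add: z_axis_def vline_def)

lemma vline_eq: "vline a b = param_line (vector [a, b, 0]) (vector [0, 0, 1])"
proof (intro set_eqI iffI)
  fix x assume "x \<in> vline a b"
  then have "x = vector [a, b, 0] + x$3 *\<^sub>R vector [0, 0, 1]"
    by (simp add: vline_def vec_eq_iff forall_3)
  then show "x \<in> param_line (vector [a, b, 0]) (vector [0, 0, 1])"
    unfolding param_line_def by blast
qed (auto simp: vline_def param_line_def)

lemma is_line_vline: "is_line (vline a b)"
  unfolding vline_eq by (rule is_line_param_line) (simp add: vec_eq_iff forall_3)

lemma vertical_line_iff: "vertical_line v \<longleftrightarrow> (\<exists>a b. v = vline a b)"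
proof
  assume "vertical_line v"
  then obtain c where c: "v = (\<lambda>x. c + x) ` vline 0 0"
    unfolding vertical_line_def affine_parallel_def z_axis_eq by blast
  have "v = vline (c$1) (c$2)"
  proof (intro set_eqI iffI)
    fix x assume "x \<in> vline (c$1) (c$2)"
    then have "x - c \<in> vline 0 0" by (simp add: vline_def)
    then show "x \<in> v" unfolding c by (intro image_eqI[of _ _ "x - c"]) auto
  qed (auto simp: c vline_def)
  then show "\<exists>a b. v = vline a b" by blast
next
  assume "\<exists>a b. v = vline a b"
  then obtain a b where v: "v = vline a b" by blast
  have "vline a b = (\<lambda>x. vector [a, b, 0] + x) ` vline 0 0"
  proof (intro set_eqI iffI)
    fix x assume "x \<in> vline a b"
    then show "x \<in> (\<lambda>x. vector [a, b, 0] + x) ` vline 0 0"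
      by (intro image_eqI[of _ _ "x - vector [a, b, 0]"]) (auto simp: vline_def)
  qed (auto simp: vline_def)
  then show "vertical_line v"
    unfolding v vertical_line_def affine_parallel_def z_axis_eq using is_line_vline by blast
qed

section \<open>Vertical order of two parametrized lines\<close>

lemma vertical_transversal_param_line:
  "vertical_transversal v (param_line b f) (param_line p d) \<longleftrightarrow>
    (\<exists>s r. v = vline ((b + s *\<^sub>R f)$1) ((b + s *\<^sub>R f)$2) \<and>
      (b + s *\<^sub>R f)$1 = (p + r *\<^sub>R d)$1 \<and> (b + s *\<^sub>R f)$2 = (p + r *\<^sub>R d)$2)"
    (is "?l \<longleftrightarrow> ?r")
proof
  assume ?l
  then obtain x y where v: "v = vline x y" "v \<inter> param_line b f \<noteq> {}" "v \<inter> param_line p d \<noteq> {}"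
    unfolding vertical_transversal_def vertical_line_iff by blast
  from v(2) obtain s where s: "b + s *\<^sub>R f \<in> v" unfolding param_line_def by blast
  from v(3) obtain r where "p + r *\<^sub>R d \<in> v" unfolding param_line_def by blast
  with s show ?r unfolding v(1) by (intro exI[of _ s] exI[of _ r]) (simp add: vline_def)
next
  assume ?r
  then obtain s r where v: "v = vline ((b + s *\<^sub>R f)$1) ((b + s *\<^sub>R f)$2)"
      "(b + s *\<^sub>R f)$1 = (p + r *\<^sub>R d)$1 \<and> (b + s *\<^sub>R f)$2 = (p + r *\<^sub>R d)$2" by (elim exE conjE) blast
  then have "b + s *\<^sub>R f \<in> v" "p + r *\<^sub>R d \<in> v" by (simp_all add: vline_def)
  moreover have "b + s *\<^sub>R f \<in> param_line b f" "p + r *\<^sub>R d \<in> param_line p d"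
    unfolding param_line_def by blast+
  ultimately show ?l unfolding vertical_transversal_def vertical_line_iff using v(1) by blast
qed

text \<open>Cramer's rule for the intersection of the projections to the xy-plane.\<close>

lemma projections_meet_iff:
  fixes b f p d :: "real^3"
  defines "h \<equiv> f$1 * d$2 - f$2 * d$1"
  assumes "h \<noteq> 0"
  shows "(b + s *\<^sub>R f)$1 = (p + r *\<^sub>R d)$1 \<and> (b + s *\<^sub>R f)$2 = (p + r *\<^sub>R d)$2 \<longleftrightarrow>
    s = ((p$1 - b$1) * d$2 - (p$2 - b$2) * d$1) / h \<and>
    r = ((p$1 - b$1) * f$2 - (p$2 - b$2) * f$1) / h" (is "?l \<longleftrightarrow> ?r")
proof
  assume ?l
  then have "b$1 + s * f$1 = p$1 + r * d$1" "b$2 + s * f$2 = p$2 + r * d$2" by simp_all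
  then have "s * h = (p$1 - b$1) * d$2 - (p$2 - b$2) * d$1"
    "r * h = (p$1 - b$1) * f$2 - (p$2 - b$2) * f$1"
    unfolding h_def by algebra+
  then show ?r using assms(2) by (simp add: eq_divide_eq)
next
  assume ?r
  then have "s * h = (p$1 - b$1) * d$2 - (p$2 - b$2) * d$1"
    "r * h = (p$1 - b$1) * f$2 - (p$2 - b$2) * f$1"
    using assms(2) by simp_all
  then have "h * (b$1 + s * f$1) = h * (p$1 + r * d$1)" "h * (b$2 + s * f$2) = h * (p$2 + r * d$2)"
    unfolding h_def by algebra+
  then show ?l using assms(2) by simp
qed

text \<open>The right-hand side is the height difference on the unique vertical transversal,
  multiplied by the square of \<open>h\<close> to remove the denominators.\<close>

lemma lies_below_param_line_iff:
  fixes b f p d :: "real^3"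
  defines "h \<equiv> f$1 * d$2 - f$2 * d$1"
  assumes h: "h \<noteq> 0"
  shows "lies_below (param_line b f) (param_line p d) \<longleftrightarrow>
    0 < h * (h * (p$3 - b$3) + ((p$1 - b$1) * f$2 - (p$2 - b$2) * f$1) * d$3
      - ((p$1 - b$1) * d$2 - (p$2 - b$2) * d$1) * f$3)"
proof -
  define s where "s = ((p$1 - b$1) * d$2 - (p$2 - b$2) * d$1) / h"
  define r where "r = ((p$1 - b$1) * f$2 - (p$2 - b$2) * f$1) / h"
  define v where "v = vline ((b + s *\<^sub>R f)$1) ((b + s *\<^sub>R f)$2)"
  have meet: "(b + s' *\<^sub>R f)$1 = (p + r' *\<^sub>R d)$1 \<and> (b + s' *\<^sub>R f)$2 = (p + r' *\<^sub>R d)$2 \<longleftrightarrow> s' = s \<and> r' = r" for s' r'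
    unfolding s_def r_def h_def by (rule projections_meet_iff[OF h[unfolded h_def]])
  have trans: "vertical_transversal w (param_line b f) (param_line p d) \<longleftrightarrow> w = v" for w
    unfolding vertical_transversal_param_line v_def meet by blast
  have "q \<in> v \<inter> param_line b f \<longleftrightarrow> q = b + s *\<^sub>R f" for q
  proof
    assume q': "q \<in> v \<inter> param_line b f"
    then obtain s' where q: "q = b + s' *\<^sub>R f" by (auto simp: param_line_def)
    moreover have "q$1 = (b + s *\<^sub>R f)$1" "q$2 = (b + s *\<^sub>R f)$2"
      using q' by (simp_all add: v_def vline_def)
    ultimately have "(b + s' *\<^sub>R f)$1 = (b + s *\<^sub>R f)$1" "(b + s' *\<^sub>R f)$2 = (b + s *\<^sub>R f)$2"
      by simp_all
    then have "(b + s' *\<^sub>R f)$1 = (p + r *\<^sub>R d)$1 \<and> (b + s' *\<^sub>R f)$2 = (p + r *\<^sub>R d)$2"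
      using meet[of s r] by presburger
    then have "s' = s" using meet[of s' r] by blast
    then show "q = b + s *\<^sub>R f" using q by simp
  qed (auto simp: v_def vline_def param_line_def)
  then have L: "v \<inter> param_line b f = {b + s *\<^sub>R f}" by blast
  have "q \<in> v \<inter> param_line p d \<longleftrightarrow> q = p + r *\<^sub>R d" for q
  proof
    assume q': "q \<in> v \<inter> param_line p d"
    then obtain r' where q: "q = p + r' *\<^sub>R d" by (auto simp: param_line_def)
    have "(b + s *\<^sub>R f)$1 = (p + r' *\<^sub>R d)$1 \<and> (b + s *\<^sub>R f)$2 = (p + r' *\<^sub>R d)$2"
      using q' unfolding q by (simp add: v_def vline_def)
    then have "r' = r" using meet[of s r'] by blast
    then show "q = p + r *\<^sub>R d" using q by simp
  qed (use meet[of s r] in \<open>auto simp: v_def vline_def param_line_def\<close>)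
  then have L': "v \<inter> param_line p d = {p + r *\<^sub>R d}" by blast
  have "lies_below (param_line b f) (param_line p d) \<longleftrightarrow> (b + s *\<^sub>R f)$3 < (p + r *\<^sub>R d)$3"
    unfolding lies_below_def vertically_comparable_def trans using L L' by simp
  also have "\<dots> \<longleftrightarrow> 0 < h\<^sup>2 * (p$3 - b$3 + r * d$3 - s * f$3)"
    using h by (auto simp: zero_less_mult_iff)
  also have "h\<^sup>2 * (p$3 - b$3 + r * d$3 - s * f$3) =
    h * (h * (p$3 - b$3) + ((p$1 - b$1) * f$2 - (p$2 - b$2) * f$1) * d$3
      - ((p$1 - b$1) * d$2 - (p$2 - b$2) * d$1) * f$3)"
    using h unfolding r_def s_def by (simp add: power2_eq_square field_simps)
  finally show ?thesis .
qed

lemma nonvertical_param_line: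
  assumes "d \<noteq> 0" "\<not> vertical_line (param_line p d)"
  shows "d$1 \<noteq> 0 \<or> d$2 \<noteq> 0"
proof (rule ccontr)
  assume c: "\<not> ?thesis"
  then have d3: "d$3 \<noteq> 0" using assms(1) by (auto simp: vec_eq_iff forall_3)
  have "param_line p d = vline (p$1) (p$2)"
  proof (intro set_eqI iffI)
    fix x assume "x \<in> vline (p$1) (p$2)"
    then have "x = p + ((x$3 - p$3) / d$3) *\<^sub>R d"
      using c d3 by (simp add: vline_def vec_eq_iff forall_3)
    then show "x \<in> param_line p d" unfolding param_line_def by blast
  qed (use c in \<open>auto simp: vline_def param_line_def\<close>)
  then show False using assms(2) vertical_line_iff by blast
qed

text \<open>If the projected directions were proportional with factor \<open>c\<close>, a vertical
  transversal could slide along both lines, by 1 in the parameter of the first and by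
  \<open>c\<close> in that of the second, giving another transversal.\<close>

lemma comparable_imp_cross_nonzero:
  assumes comp: "vertically_comparable (param_line p d) (param_line q e)"
    and d: "d$1 \<noteq> 0 \<or> d$2 \<noteq> 0" and e: "e$1 \<noteq> 0 \<or> e$2 \<noteq> 0"
  shows "d$1 * e$2 - d$2 * e$1 \<noteq> 0"
proof
  assume 0: "d$1 * e$2 - d$2 * e$1 = 0"
  define c where "c = (d$1 * e$1 + d$2 * e$2) / ((e$1)\<^sup>2 + (e$2)\<^sup>2)"
  have ne: "(e$1)\<^sup>2 + (e$2)\<^sup>2 \<noteq> 0" using e by (simp add: sum_power2_eq_zero_iff)
  have "d$1 * ((e$1)\<^sup>2 + (e$2)\<^sup>2) = (d$1 * e$1 + d$2 * e$2) * e$1"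
    "d$2 * ((e$1)\<^sup>2 + (e$2)\<^sup>2) = (d$1 * e$1 + d$2 * e$2) * e$2" using 0 by algebra+
  then have c: "d$1 = c * e$1" "d$2 = c * e$2" unfolding c_def using ne by (simp_all add: field_simps)
  obtain s r where sr: "(p + s *\<^sub>R d)$1 = (q + r *\<^sub>R e)$1" "(p + s *\<^sub>R d)$2 = (q + r *\<^sub>R e)$2"
      and uniq: "\<And>v. vertical_transversal v (param_line p d) (param_line q e) \<Longrightarrow>
        v = vline ((p + s *\<^sub>R d)$1) ((p + s *\<^sub>R d)$2)"
    using comp unfolding vertically_comparable_def vertical_transversal_param_line by (elim ex1E) metis
  have tr: "vertical_transversal (vline ((p + (s + 1) *\<^sub>R d)$1) ((p + (s + 1) *\<^sub>R d)$2))
      (param_line p d) (param_line q e)"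
    unfolding vertical_transversal_param_line
    using sr c by (intro exI[of _ "s + 1"] exI[of _ "r + c"]) (simp add: algebra_simps)
  have "p + (s + 1) *\<^sub>R d \<in> vline ((p + s *\<^sub>R d)$1) ((p + s *\<^sub>R d)$2)"
    unfolding uniq[OF tr, symmetric] by (simp add: vline_def)
  then show False using d by (simp add: vline_def algebra_simps)
qed

section \<open>Lines in the rotating vertical plane\<close>

text \<open>With \<open>u\<close> the horizontal direction of the plane, \<open>n\<close> its normal
  and \<open>k\<close> the upward unit vector, the base point is
  \<open>\<eta> n + v (cos \<psi> k - sin \<psi> u)\<close> and the direction is
  \<open>cos \<psi> u + sin \<psi> k\<close>. Thus \<open>v\<close> is the signed distance from the
  plane's origin, and vertical lines are covered as well.\<close>

definition sweep_line :: "real \<Rightarrow> real \<Rightarrow> real \<Rightarrow> real \<Rightarrow> (real^3) set" where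
  "sweep_line \<eta> \<theta> \<psi> v = param_line
     (vector [- \<eta> * sin \<theta> - v * sin \<psi> * cos \<theta>, \<eta> * cos \<theta> - v * sin \<psi> * sin \<theta>, v * cos \<psi>])
     (vector [cos \<psi> * cos \<theta>, cos \<psi> * sin \<theta>, sin \<psi>])"

lemma cos_or_sin_nonzero: "cos x \<noteq> 0 \<or> sin x \<noteq> (0 :: real)"
  using sin_zero_abs_cos_one[of x] by auto

lemma is_line_sweep_line: "is_line (sweep_line \<eta> \<theta> \<psi> v)"
  unfolding sweep_line_def
proof (rule is_line_param_line)
  have "cos \<theta> \<noteq> 0 \<or> sin \<theta> \<noteq> 0" "cos \<psi> \<noteq> 0 \<or> sin \<psi> \<noteq> 0"
    by (rule cos_or_sin_nonzero)+
  then show "vector [cos \<psi> * cos \<theta>, cos \<psi> * sin \<theta>, sin \<psi>] \<noteq> (0 :: real^3)"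
    by (auto simp: vec_eq_iff forall_3)
qed

text \<open>For these lines the determinant is \<open>cos \<psi> * den d \<theta>\<close>, and the
  quantity in the general criterion becomes \<open>- cos \<psi> * side\<close>, where the cosine is
  positive.\<close>

lemma lies_below_sweep_line_iff:
  assumes \<psi>: "0 < cos \<psi>" and den: "den d \<theta> \<noteq> 0"
  shows "lies_below (sweep_line \<eta> \<theta> \<psi> v) (param_line p d) \<longleftrightarrow> side p d \<eta> \<theta> \<psi> v < 0"
proof -
  have pyth: "cos \<theta> * cos \<theta> = 1 - sin \<theta> * sin \<theta>" "cos \<psi> * cos \<psi> = 1 - sin \<psi> * sin \<psi>"
    using sin_cos_squared_add[of \<theta>] sin_cos_squared_add[of \<psi>] by (simp_all add: power2_eq_square)
  let ?b = "vector [- \<eta> * sin \<theta> - v * sin \<psi> * cos \<theta>, \<eta> * cos \<theta> - v * sin \<psi> * sin \<theta>, v * cos \<psi>] :: real^3"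
  let ?f = "vector [cos \<psi> * cos \<theta>, cos \<psi> * sin \<theta>, sin \<psi>] :: real^3"
  have h: "?f$1 * d$2 - ?f$2 * d$1 = cos \<psi> * den d \<theta>"
    by (simp add: den_def algebra_simps)
  have nz: "?f$1 * d$2 - ?f$2 * d$1 \<noteq> 0" unfolding h using assms by simp
  have "cos \<psi> * den d \<theta> * (p$3 - ?b$3) + ((p$1 - ?b$1) * ?f$2 - (p$2 - ?b$2) * ?f$1) * d$3
      - ((p$1 - ?b$1) * d$2 - (p$2 - ?b$2) * d$1) * ?f$3 = num p d \<eta> \<theta> \<psi> - den d \<theta> * v"
    unfolding num_def ver_def hor_def den_def vector_3 using pyth by algebra
  then have "lies_below (sweep_line \<eta> \<theta> \<psi> v) (param_line p d) \<longleftrightarrow>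
      0 < cos \<psi> * den d \<theta> * (num p d \<eta> \<theta> \<psi> - den d \<theta> * v)"
    unfolding sweep_line_def lies_below_param_line_iff[OF nz] h by simp
  also have "cos \<psi> * den d \<theta> * (num p d \<eta> \<theta> \<psi> - den d \<theta> * v) = cos \<psi> * - side p d \<eta> \<theta> \<psi> v"
    by (simp add: side_def algebra_simps)
  finally show ?thesis using \<psi> by (simp only: zero_less_mult_iff) auto
qed

text \<open>This turns ties into intersections. Vertical sweep lines are included, since the slope
  angle of the common middle may be an end point of its interval.\<close>

lemma sweep_line_meets:
  assumes den: "den d \<theta> \<noteq> 0" and v: "den d \<theta> * v = num p d 0 \<theta> \<psi>"
  shows "sweep_line 0 \<theta> \<psi> v \<inter> param_line p d \<noteq> {}"
proof -
  have pyth: "cos \<theta> * cos \<theta> = 1 - sin \<theta> * sin \<theta>" "cos \<psi> * cos \<psi> = 1 - sin \<psi> * sin \<psi>"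
    using sin_cos_squared_add[of \<theta>] sin_cos_squared_add[of \<psi>] by (simp_all add: power2_eq_square)
  define e where "e = den d \<theta>"
  \<comment> \<open>\<open>r\<close> is the parameter at which the given line crosses the plane, and
    \<open>s\<close> is the inner product of the crossing point with the unit direction of the sweep
    line, whose base point is orthogonal to that direction.\<close>
  define r where "r = - (cos \<theta> * p$2 - sin \<theta> * p$1) / e"
  define s where "s = cos \<psi> * (cos \<theta> * (p$1 + r * d$1) + sin \<theta> * (p$2 + r * d$2)) + sin \<psi> * (p$3 + r * d$3)"
  have r: "e * r = - (cos \<theta> * p$2 - sin \<theta> * p$1)" using den unfolding r_def e_def by simp
  have e: "e = cos \<theta> * d$2 - sin \<theta> * d$1" by (simp add: e_def den_def)
  have v': "e * v = cos \<psi> * (p$3 * e - d$3 * (cos \<theta> * p$2 - sin \<theta> * p$1)) - sin \<psi> * (p$1 * d$2 - p$2 * d$1)"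
    using v by (simp add: num_def ver_def hor_def e_def)
  have "e * (- v * sin \<psi> * cos \<theta> + s * (cos \<psi> * cos \<theta>)) = e * (p$1 + r * d$1)"
    "e * (- v * sin \<psi> * sin \<theta> + s * (cos \<psi> * sin \<theta>)) = e * (p$2 + r * d$2)"
    "e * (v * cos \<psi> + s * sin \<psi>) = e * (p$3 + r * d$3)"
    using pyth r v' e unfolding s_def by algebra+
  then have "vector [- v * sin \<psi> * cos \<theta>, - v * sin \<psi> * sin \<theta>, v * cos \<psi>] +
      s *\<^sub>R vector [cos \<psi> * cos \<theta>, cos \<psi> * sin \<theta>, sin \<psi>] = p + r *\<^sub>R d"
    using den by (simp add: vec_eq_iff forall_3 e_def)
  then show ?thesis unfolding sweep_line_def param_line_def by auto
qed

text \<open>Being in a vertical plane through the origin, an unshifted sweep line cannot meet four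
  lines in general position.\<close>

lemma vertical_plane_sweep:
  fixes \<theta> :: real
  defines "P \<equiv> {x :: real^3. cos \<theta> * x$2 - sin \<theta> * x$1 = 0}"
  shows "vertical_plane P" "sweep_line 0 \<theta> \<psi> v \<subseteq> P" "0 \<in> P"
proof -
  let ?n = "vector [- sin \<theta>, cos \<theta>, 0] :: real^3"
  have P: "P = {x. ?n \<bullet> x = 0}"
    by (auto simp: P_def inner_vec_def sum_3)
  have "?n \<noteq> 0" using cos_or_sin_nonzero[of \<theta>] by (auto simp: vec_eq_iff forall_3)
  then have "aff_dim P = 2" unfolding P by (simp add: aff_dim_hyperplane)
  moreover have "affine P" unfolding P by (rule affine_hyperplane)
  moreover have "vline 0 0 \<subseteq> P" by (auto simp: vline_def P_def)
  ultimately show "vertical_plane P"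
    unfolding vertical_plane_def using vertical_line_iff by blast
  show "sweep_line 0 \<theta> \<psi> v \<subseteq> P"
    by (auto simp: sweep_line_def param_line_def P_def algebra_simps)
  show "0 \<in> P" by (simp add: P_def)
qed

lemma den_add_pi: "den d (\<theta> + pi) = - den d \<theta>"
  by (simp add: den_def)

lemma num_add_pi: "num p d \<eta> \<theta> (\<psi> + pi) = - num p d \<eta> \<theta> \<psi>"
  by (simp add: num_def)

text \<open>Turning the plane by \<open>pi\<close> reverses its horizontal direction, and the
  opposite slope angle then describes the same line with the same \<open>v\<close>. This needs zero
  shift, because the normal is reversed too.\<close>

lemma num_flip: "num p d 0 (\<theta> + pi) (- \<psi>) = - num p d 0 \<theta> \<psi>"
  by (simp add: num_def ver_def hor_def den_def algebra_simps)

text \<open>Both projected directions are multiples of \<open>(cos \<theta>, sin \<theta>)\<close>.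
  Hence comparable lines are never parallel to the same plane of the pencil.\<close>

lemma den_zero_imp_parallel:
  assumes "den d \<theta> = 0" "den e \<theta> = 0"
  shows "d$1 * e$2 - d$2 * e$1 = 0"
proof -
  have "cos \<theta> * (d$1 * e$2 - d$2 * e$1) = 0" "sin \<theta> * (d$1 * e$2 - d$2 * e$1) = 0"
    using assms unfolding den_def by algebra+
  then show ?thesis using cos_or_sin_nonzero[of \<theta>] by auto
qed

lemma side_eq: "den d \<theta> \<noteq> 0 \<Longrightarrow> side p d \<eta> \<theta> \<psi> v = (den d \<theta>)\<^sup>2 * (v - num p d \<eta> \<theta> \<psi> / den d \<theta>)"
  by (simp add: side_def power2_eq_square field_simps)

lemma exists_gap:
  fixes f :: "'a \<Rightarrow> real"
  assumes "finite S" "\<And>x. x \<in> S \<Longrightarrow> 0 < f x"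
  obtains r where "0 < r" "\<forall>x\<in>S. 2 * r < f x"
proof
  \<comment> \<open>The additional 1 covers the case of empty \<open>S\<close>.\<close>
  have fin: "finite (insert 1 (f ` S))" using assms(1) by simp
  show "0 < Min (insert 1 (f ` S)) / 3" using fin assms(2) by (simp add: Min_gr_iff)
  show "\<forall>x\<in>S. 2 * (Min (insert 1 (f ` S)) / 3) < f x"
  proof
    fix x assume "x \<in> S"
    then show "2 * (Min (insert 1 (f ` S)) / 3) < f x"
      using Min_le[OF fin, of "f x"] assms(2)[of x] by auto
  qed
qed

theorem theorem8:
  fixes R B G :: "(real ^ 3) set set"
  assumes "finite R" and "finite B" and "finite G"
    and "\<forall>L \<in> R \<union> B \<union> G. is_line L"
    and "R \<inter> B = {}" and "R \<inter> G = {}" and "B \<inter> G = {}"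
    and "general_position (R \<union> B \<union> G)"
    and "pairwise vertically_comparable (R \<union> B \<union> G)"
    and "even (card R)" and "even (card B)" and "even (card G)"
  shows "\<exists>l. is_line l \<and>
    card {L \<in> R. lies_below l L} = card R div 2 \<and>
    card {L \<in> B. lies_below l L} = card B div 2 \<and>
    card {L \<in> G. lies_below l L} = card G div 2"
proof -
  define A where "A = R \<union> B \<union> G"
  have finA: "finite A" using assms(1-3) by (simp add: A_def)
  have "\<forall>L\<in>A. \<exists>p d. d \<noteq> 0 \<and> L = param_line p d"
    using assms(4) is_line_imp_param_line unfolding A_def by metis
  then obtain p d where line: "\<And>L. L \<in> A \<Longrightarrow> d L \<noteq> 0 \<and> L = param_line (p L) (d L)"
    by metis
  have nonvert: "d L$1 \<noteq> 0 \<or> d L$2 \<noteq> 0" if "L \<in> A" for L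
  proof (rule nonvertical_param_line)
    show "d L \<noteq> 0" using line[OF that] by simp
    show "\<not> vertical_line (param_line (p L) (d L))"
      using assms(8) that line[OF that] unfolding general_position_def A_def by metis
  qed
  have cross: "d K$1 * d L$2 - d K$2 * d L$1 \<noteq> 0" if "K \<in> A" "L \<in> A" "K \<noteq> L" for K L
  proof (rule comparable_imp_cross_nonzero[OF _ nonvert[OF that(1)] nonvert[OF that(2)]])
    have "vertically_comparable K L" using assms(9) that unfolding pairwise_def A_def by blast
    then show "vertically_comparable (param_line (p K) (d K)) (param_line (p L) (d L))"
      using line that by simp
  qed
  have one: "K = L" if "K \<in> A" "L \<in> A" "den (d K) \<theta> = 0" "den (d L) \<theta> = 0" for K L \<theta>
    using cross[OF that(1,2)] den_zero_imp_parallel[OF that(3,4)] by blast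
  obtain \<psi> \<theta> v where \<psi>: "- (pi/2) \<le> \<psi>" "\<psi> \<le> pi/2"
    and halved: "\<forall>X\<in>{R, B, G}.
      halved X (\<lambda>L. den (d L) \<theta> * (den (d L) \<theta> * v - num (p L) (d L) 0 \<theta> \<psi>))"
  proof (rule exists_common_middle[OF assms(1-3,10-12),
      where e = "\<lambda>L. den (d L)" and N = "\<lambda>L. num (p L) (d L) 0"])
    show "continuous_on UNIV (den (d L))" for L
      unfolding den_def[abs_def] by (intro continuous_intros)
    show "continuous_on UNIV (\<lambda>x. num (p L) (d L) 0 (fst x) (snd x))" for L
      unfolding num_def ver_def hor_def den_def by (intro continuous_intros)
    show "K = L" if "K \<in> R \<union> B \<union> G" "L \<in> R \<union> B \<union> G" "den (d K) \<theta> = 0" "den (d L) \<theta> = 0" for K L \<theta>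
      using one that unfolding A_def by blast
  qed (rule den_add_pi num_add_pi num_flip)+
  define a where "a L = side (p L) (d L) 0 \<theta> \<psi> v" for L
  define P where "P = {L \<in> A. den (d L) \<theta> = 0}"
  have nonpar: "A - P = {L \<in> A. den (d L) \<theta> \<noteq> 0}" by (auto simp: P_def)
  have cardP: "card P \<le> 1"
    using one finA by (auto simp: card_le_Suc0_iff_eq P_def)
  \<comment> \<open>Four tied lines would have a common transversal in a vertical plane through the
    origin.\<close>
  have ties: "card {L \<in> A - P. a L = 0} \<le> 3"
  proof (rule ccontr)
    assume "\<not> ?thesis"
    then have "4 \<le> card {L \<in> A - P. a L = 0}" by simp
    then obtain S where S: "S \<subseteq> {L \<in> A - P. a L = 0}" "card S = 4"
      by (rule obtain_subset_with_card_n)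
    have meets: "sweep_line 0 \<theta> \<psi> v \<inter> L \<noteq> {}" if "L \<in> S" for L
    proof -
      have L: "L \<in> A" "den (d L) \<theta> \<noteq> 0" "a L = 0" using S(1) that by (auto simp: P_def)
      then have "den (d L) \<theta> * v = num (p L) (d L) 0 \<theta> \<psi>" by (simp add: a_def side_def)
      from sweep_line_meets[OF L(2) this] show ?thesis using line[OF L(1)] by simp
    qed
    have "S \<subseteq> R \<union> B \<union> G" using S(1) unfolding A_def by blast
    moreover have "\<forall>\<A>\<subseteq>R \<union> B \<union> G. card \<A> = 4 \<longrightarrow>
        (\<forall>m. is_line m \<and> (\<forall>L\<in>\<A>. m \<inter> L \<noteq> {}) \<longrightarrow>
          (\<forall>P. vertical_plane P \<and> m \<subseteq> P \<longrightarrow> 0 \<notin> P))"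
      using assms(8) unfolding general_position_def by (elim conjE)
    ultimately show False
      using S(2) is_line_sweep_line[of 0 \<theta> \<psi> v] meets
        vertical_plane_sweep(1)[of \<theta>] vertical_plane_sweep(2)[of \<theta> \<psi> v] vertical_plane_sweep(3)[of \<theta>]
      by blast
  qed
  define V where "V L = num (p L) (d L) 0 \<theta> \<psi> / den (d L) \<theta>" for L
  have a_sign: "(0 < a L) = (V L < v)" "(a L < 0) = (v < V L)" "(a L = 0) = (V L = v)" if "L \<in> A - P" for L
    using that side_eq[of "d L" \<theta> "p L" 0 \<psi> v] unfolding a_def nonpar V_def
    by (auto simp: zero_less_mult_iff mult_less_0_iff)
  \<comment> \<open>Untied offsets are more than \<open>2 * r\<close> away from \<open>v\<close>;
    after a change by less than \<open>r\<close> they are still more than \<open>r\<close> away, on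
    the same side.\<close>
  obtain r where r: "0 < r" "\<forall>L\<in>{L \<in> A - P. a L \<noteq> 0}. 2 * r < \<bar>V L - v\<bar>"
    by (rule exists_gap[of "{L \<in> A - P. a L \<noteq> 0}" "\<lambda>L. \<bar>V L - v\<bar>"]) (use finA a_sign(3) in auto)
  \<comment> \<open>The angle \<theta> is kept, so the same lines stay parallel to the plane; only
    the shift and the slope change.\<close>
  obtain \<phi> \<eta> where \<phi>: "- (pi/2) < \<phi>" "\<phi> < pi/2"
    and inj: "inj_on (\<lambda>L. num (p L) (d L) \<eta> \<theta> \<phi> / den (d L) \<theta>) {L \<in> A. den (d L) \<theta> \<noteq> 0}"
    and close: "\<forall>L\<in>A. den (d L) \<theta> \<noteq> 0 \<longrightarrow>
      \<bar>num (p L) (d L) \<eta> \<theta> \<phi> / den (d L) \<theta> - num (p L) (d L) 0 \<theta> \<psi> / den (d L) \<theta>\<bar> < r"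
    and num0: "\<forall>L\<in>A. den (d L) \<theta> = 0 \<longrightarrow> num (p L) (d L) \<eta> \<theta> \<phi> \<noteq> 0"
    by (rule exists_generic_perturbation[where p = p and \<theta> = \<theta>, OF finA cross nonvert r(1) \<psi>])
  define b where "b L = num (p L) (d L) \<eta> \<theta> \<phi> / den (d L) \<theta>" for L
  have close': "\<bar>b L - V L\<bar> < r" if "L \<in> A - P" for L
    using close that unfolding nonpar b_def V_def by blast
  \<comment> \<open>The offsets are now distinct, and only those of formerly tied lines lie within
    \<open>r\<close> of \<open>v\<close>, so a cut there can split the ties.\<close>
  obtain w where w: "\<forall>L\<in>A - P. b L \<noteq> w"
    and cut: "\<forall>X\<in>{R, B, G}. 2 * card {L \<in> X - P. w < b L} = card X \<or>
       X \<inter> P \<noteq> {} \<and> 2 * (card {L \<in> X - P. w < b L} + 1) = card X"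
  proof (rule exists_common_cut[OF assms(1-3,5-7), of P a b r v, folded A_def])
    show "even (card X)" if "X \<in> {R, B, G}" for X using that assms(10-12) by (elim insertE emptyE) simp_all
    show "P \<subseteq> A" by (auto simp: P_def)
    show "a L = 0" if "L \<in> P" for L using that by (simp add: a_def side_def P_def)
    show "halved X a" if "X \<in> {R, B, G}" for X
      using bspec[OF halved that] by (simp add: a_def[abs_def] side_def)
    show "inj_on b (A - P)" using inj unfolding nonpar b_def[abs_def] .
    fix L assume L: "L \<in> A - P"
    show "\<bar>b L - v\<bar> < r" if "a L = 0" using close'[OF L] a_sign(3)[OF L] that by simp
    show "b L < v - r" if "0 < a L" using close'[OF L] a_sign(1)[OF L] r(2) L that by auto
    show "v + r < b L" if "a L < 0" using close'[OF L] a_sign(2)[OF L] r(2) L that by auto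
  qed (use cardP ties r(1) in auto)
  have b_sign: "(side (p L) (d L) \<eta> \<theta> \<phi> w < 0) = (w < b L)" "side (p L) (d L) \<eta> \<theta> \<phi> w \<noteq> 0"
    if "L \<in> A - P" for L
    using that bspec[OF w that] side_eq[of "d L" \<theta> "p L" \<eta> \<phi> w] unfolding nonpar b_def
    by (auto simp: mult_less_0_iff)
  \<comment> \<open>The parallel line has to end up above \<open>l\<close> exactly if its class is
    one short of half.\<close>
  define below where "below \<longleftrightarrow>
    (\<exists>X\<in>{R, B, G}. X \<inter> P \<noteq> {} \<and> 2 * (card {L \<in> X - P. w < b L} + 1) = card X)"
  obtain \<theta>' where t1: "\<forall>L\<in>A. den (d L) \<theta> \<noteq> 0 \<longrightarrow>
      sgn (side (p L) (d L) \<eta> \<theta>' \<phi> w) = sgn (side (p L) (d L) \<eta> \<theta> \<phi> w)"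
    and t2: "\<forall>L\<in>A. den (d L) \<theta> = 0 \<longrightarrow>
      sgn (side (p L) (d L) \<eta> \<theta>' \<phi> w) = (if below then -1 else 1)"
    by (rule exists_tilt[where d = d and p = p and \<theta> = \<theta> and \<eta> = \<eta> and \<psi> = \<phi> and v = w
          and below = below, OF finA one nonvert])
      (use b_sign(2) num0 in \<open>auto simp: nonpar\<close>)
  define l where "l = sweep_line \<eta> \<theta>' \<phi> w"
  have l_below: "lies_below l L \<longleftrightarrow> side (p L) (d L) \<eta> \<theta>' \<phi> w < 0"
    if "L \<in> A" "side (p L) (d L) \<eta> \<theta>' \<phi> w \<noteq> 0" for L
  proof -
    have "den (d L) \<theta>' \<noteq> 0" using that(2) by (auto simp: side_def)
    from lies_below_sweep_line_iff[OF cos_gt_zero_pi[OF \<phi>] this] show ?thesis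
      unfolding l_def using line[OF that(1)] by metis
  qed
  have l_nonpar: "lies_below l L \<longleftrightarrow> w < b L" if "L \<in> A - P" for L
  proof -
    have L: "L \<in> A" "den (d L) \<theta> \<noteq> 0" using that by (auto simp: P_def)
    have "side (p L) (d L) \<eta> \<theta>' \<phi> w \<noteq> 0" using t1[rule_format, OF L] b_sign(2)[OF that] by (metis sgn_0_0)
    from l_below[OF L(1) this] show ?thesis
      using t1[rule_format, OF L] b_sign(1)[OF that] by (metis sgn_less)
  qed
  have l_par: "lies_below l L \<longleftrightarrow> below" if "L \<in> P" for L
  proof -
    have L: "L \<in> A" "den (d L) \<theta> = 0" using that by (auto simp: P_def)
    have "side (p L) (d L) \<eta> \<theta>' \<phi> w \<noteq> 0" using t2[rule_format, OF L] by (auto split: if_splits)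
    from l_below[OF L(1) this] show ?thesis
      using t2[rule_format, OF L] sgn_less[of "side (p L) (d L) \<eta> \<theta>' \<phi> w"] by (auto split: if_splits)
  qed
  have twice: "2 * card {L \<in> X. lies_below l L} = card X" if X: "X \<in> {R, B, G}" for X
  proof -
    have XA: "X \<subseteq> A" "finite X" using X assms(1-3) by (elim insertE emptyE; auto simp: A_def)+
    have eq: "{L \<in> X. lies_below l L} = {L \<in> X - P. w < b L} \<union> (if below then X \<inter> P else {})"
      using XA(1) l_nonpar l_par by auto
    show ?thesis
    proof (cases "X \<inter> P = {}")
      case True
      then show ?thesis using bspec[OF cut X] unfolding eq by auto
    next
      case False
      have finP: "finite P" using finA by (simp add: P_def)
      have one_par: "card (X \<inter> P) = 1"
        using False card_mono[OF finP, of "X \<inter> P"] cardP finP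
        by (metis Int_lower2 card_0_eq finite_Int le_antisym less_one linorder_not_le order_trans)
      show ?thesis
      proof (cases below)
        case True
        then obtain Y where Y: "Y \<in> {R, B, G}" "Y \<inter> P \<noteq> {}" "2 * (card {L \<in> Y - P. w < b L} + 1) = card Y"
          unfolding below_def by blast
        \<comment> \<open>\<open>P\<close> has at most one element, so the class that is one short
          is the class \<open>X\<close> meeting \<open>P\<close>.\<close>
        have "Y = X"
        proof (rule ccontr)
          assume "Y \<noteq> X"
          then have "Y \<inter> X = {}" using X Y(1) assms(5-7) by (elim insertE emptyE) (simp_all add: Int_commute)
          moreover have "K = L" if "K \<in> P" "L \<in> P" for K L
            using one that unfolding P_def by blast
          ultimately show False using False Y(2) by blast
        qed
        moreover have "card {L \<in> X. lies_below l L} = card {L \<in> X - P. w < b L} + 1"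
          unfolding eq one_par[symmetric] using True XA(2) by (simp, subst card_Un_disjoint) auto
        ultimately show ?thesis using Y(3) by simp
      next
        case nb: False
        then have "\<not> (X \<inter> P \<noteq> {} \<and> 2 * (card {L \<in> X - P. w < b L} + 1) = card X)"
          using X unfolding below_def by blast
        then have "2 * card {L \<in> X - P. w < b L} = card X" using bspec[OF cut X] by argo
        then show ?thesis unfolding eq using nb by simp
      qed
    qed
  qed
  have "card {L \<in> X. lies_below l L} = card X div 2" if "X \<in> {R, B, G}" for X
    using twice[OF that] by linarith
  moreover have "is_line l" unfolding l_def by (rule is_line_sweep_line)
  ultimately show ?thesis by (intro exI[of _ l]) simp
qed

end
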